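(* Let $r$ be an odd prime. For any Fourier generic continuous map $f:\Delta_{r(r-1)}\to\mathbb{R}^{r-1}$, there exist $x_1\in\sigma_1,\dots,x_r\in\sigma_r$ from pairwise disjoint faces $\sigma_1,\dots,\sigma_r$ of $\Delta_{r(r-1)}$ with $\dim\sigma_i\le r-2$ for all $1\le i\le r$ such that $f(x_1),\dots,f(x_r)$ are the vertices of a regular $r$-gon.
   Context: $\Delta_n$ is the $n$-simplex. A coordinate plane (line) of $\mathbb{R}^D$ is the span of two distinct (one) standard basis vectors. A regular $r$-gon in $\mathbb{R}^{r-1}$ is a non-degenerate planar regular $r$-gon. Points of a simplex have pairwise disjoint support if they lie in pairwise disjoint faces. **Fourier genericity.** Let $G=\mathbb{Z}_{q_1}\oplus\cdots\oplus\mathbb{Z}_{q_l}$ ($q_j\ge2$), with characters $\chi_h(g)=\prod_{j=1}^l\zeta_{q_j}^{h_jg_j}$, $\zeta_q=e^{2\pi i/q}$, for $g,h\in G$. For a map $F=(F_1,\dots,F_{a+b}):\Delta_n\to\mathbb{C}^a\oplus\mathbb{R}^{b}$ and points $\{x_g\}_{g\in G}\subset\Delta_n$, the Fourier coefficients are $c_{i,h}=\frac1{|G|}\sum_{g\in G}F_i(x_g)\chi_h(g)^{-1}$. An admissible choice is a family $S_i\subseteq G\setminus\{0\}$, $1\le i\le a+b$, such that for each $i>a$, writing $T_i=\{h\in S_i: h\text{ has order }2\}$, one has $-h\notin S_i$ whenever $h\in S_i\setminus T_i$; put $m=\sum_{i=1}^{a+b}|S_i|$ and $m'=\sum_{i=a+1}^{a+b}|T_i|$.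 A map $f:\Delta_M\to\mathbb{R}^D$ is Fourier generic if for every such group $G$, every decomposition $\mathbb{R}^D=\bigoplus_{i=1}^aU_i\oplus\bigoplus_{j=1}^{b}L_j$ ($D=2a+b$, $a,b\ge0$, $a+b\ge1$) into pairwise orthogonal coordinate planes $U_i$ and coordinate lines $L_j$, with $\sigma:\mathbb{R}^D\to\mathbb{C}^a\oplus\mathbb{R}^{b}$ a coordinate permutation sending $U_i$ to the $i$-th complex coordinate plane and $L_j$ to the $j$-th real coordinate line, every admissible choice of the $S_i$, and every face $\Delta_n$ of $\Delta_M$ with $n<2m-m'+|G|-1$, there is no $\{x_g\}_{g\in G}\subset\Delta_n$ with pairwise disjoint support for which all Fourier coefficients $c_{i,h}$ of $(\sigma\circ f)|_{\Delta_n}$ with $h\in S_i$, $1\le i\le a+b$, vanish. *)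

theory Defs
  imports
    "HOL-Homology.Homology"
    "HOL-Computational_Algebra.Primes"
    "HOL-Algebra.Multiplicative_Group"
    "HOL-Algebra.Elementary_Groups"
    "HOL-Algebra.Product_Groups"
begin

(* Delta_M is the library's standard_simplex M, whose points are the barycentric coordinate
   vectors x :: nat => real supported on the vertices {..M}.  A face is given by the nonempty
   set A of its vertices and has dimension k = card A - 1. *)
definition simplex_face :: "nat \<Rightarrow> nat \<Rightarrow> (nat \<Rightarrow> real) set \<Rightarrow> bool" where
  "simplex_face M k \<sigma> \<longleftrightarrow>
     (\<exists>A \<subseteq> {..M}. card A = k + 1 \<and> \<sigma> = {x \<in> standard_simplex M. \<forall>i. i \<notin> A \<longrightarrow> x i = 0})"

definition disjoint_support :: "nat \<Rightarrow> 'g set \<Rightarrow> ('g \<Rightarrow> nat \<Rightarrow> real) \<Rightarrow> bool" where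
  "disjoint_support M I x \<longleftrightarrow>
     (\<exists>\<tau>. (\<forall>g\<in>I. (\<exists>k. simplex_face M k (\<tau> g)) \<and> x g \<in> \<tau> g) \<and> disjoint_family_on \<tau> I)"

definition coordinate_plane :: "(real ^ 'd) set \<Rightarrow> bool" where
  "coordinate_plane U \<longleftrightarrow> (\<exists>j k. j \<noteq> k \<and> U = span {axis j 1, axis k 1})"

definition coordinate_line :: "(real ^ 'd) set \<Rightarrow> bool" where
  "coordinate_line L \<longleftrightarrow> (\<exists>j. L = span {axis j 1})"

(* One family V lists all summands, counted from 0: V 0, ..., V (a-1) are the planes and
   V a, ..., V (a+b-1) are the lines.  Pairwise orthogonal subspaces that span the whole
   space form a direct sum. *)
definition coordinate_decomposition :: "nat \<Rightarrow> nat \<Rightarrow> (nat \<Rightarrow> (real ^ 'd) set) \<Rightarrow> bool" where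
  "coordinate_decomposition a b V \<longleftrightarrow>
     a + b \<ge> 1 \<and> CARD('d) = 2 * a + b \<and>
     (\<forall>i<a. coordinate_plane (V i)) \<and>
     (\<forall>j<b. coordinate_line (V (a + j))) \<and>
     (\<forall>i<a+b. \<forall>j<a+b. i \<noteq> j \<longrightarrow> (\<forall>u\<in>V i. \<forall>v\<in>V j. orthogonal u v)) \<and>
     span (\<Union>i<a+b. V i) = UNIV"

(* The 2a+b real coordinates of C^a + R^b are numbered Re 0, Im 0, ..., Re (a-1), Im (a-1),
   followed by the b real ones.  The coordinate permutation sigma is encoded by the bijection s
   that tells which coordinate of R^D becomes the k-th coordinate of C^a + R^b. *)
definition coordinate_permutation ::
    "nat \<Rightarrow> nat \<Rightarrow> (nat \<Rightarrow> (real ^ 'd) set) \<Rightarrow> (nat \<Rightarrow> 'd) \<Rightarrow> bool" where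
  "coordinate_permutation a b V s \<longleftrightarrow>
     bij_betw s {..<2*a+b} UNIV \<and>
     (\<forall>i<a. V i = span {axis (s (2*i)) 1, axis (s (2*i+1)) 1}) \<and>
     (\<forall>j<b. V (a + j) = span {axis (s (2*a+j)) 1})"

(* The i-th component, i < a + b, of sigma y in C^a + R^b; the real components (i >= a) are
   embedded into the complex numbers.  Note 2a + (i - a) = a + i. *)
definition sigma_component :: "nat \<Rightarrow> (nat \<Rightarrow> 'd) \<Rightarrow> real ^ 'd \<Rightarrow> nat \<Rightarrow> complex" where
  "sigma_component a s y i =
     (if i < a then Complex (y $ s (2*i)) (y $ s (2*i+1)) else complex_of_real (y $ s (a+i)))"

(* Z_{q 0} + ... + Z_{q (l-1)}, written multiplicatively as in HOL-Algebra: the unit is the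
   zero of G and inv h is -h. *)
abbreviation cyclic_sum :: "nat \<Rightarrow> (nat \<Rightarrow> nat) \<Rightarrow> (nat \<Rightarrow> int) monoid" where
  "cyclic_sum l q \<equiv> product_group {..<l} (\<lambda>j. integer_mod_group (q j))"

definition chi :: "nat \<Rightarrow> (nat \<Rightarrow> nat) \<Rightarrow> (nat \<Rightarrow> int) \<Rightarrow> (nat \<Rightarrow> int) \<Rightarrow> complex" where
  "chi l q h g = (\<Prod>j<l. exp (2 * of_real pi * \<i> / of_nat (q j)) powi (h j * g j))"

definition fourier_coeff ::
    "nat \<Rightarrow> (nat \<Rightarrow> nat) \<Rightarrow> ((nat \<Rightarrow> int) \<Rightarrow> complex) \<Rightarrow> (nat \<Rightarrow> int) \<Rightarrow> complex" where
  "fourier_coeff l q \<phi> h =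
     1 / of_nat (order (cyclic_sum l q)) *
       (\<Sum>g\<in>carrier (cyclic_sum l q). \<phi> g * inverse (chi l q h g))"

definition order_two_part :: "nat \<Rightarrow> (nat \<Rightarrow> nat) \<Rightarrow> (nat \<Rightarrow> int) set \<Rightarrow> (nat \<Rightarrow> int) set" where
  "order_two_part l q A = {h \<in> A. group.ord (cyclic_sum l q) h = 2}"

definition admissible ::
    "nat \<Rightarrow> (nat \<Rightarrow> nat) \<Rightarrow> nat \<Rightarrow> nat \<Rightarrow> (nat \<Rightarrow> (nat \<Rightarrow> int) set) \<Rightarrow> bool" where
  "admissible l q a b S \<longleftrightarrow>
     (\<forall>i<a+b. S i \<subseteq> carrier (cyclic_sum l q) - {\<one>\<^bsub>cyclic_sum l q\<^esub>}) \<and>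
     (\<forall>i\<in>{a..<a+b}. \<forall>h \<in> S i - order_two_part l q (S i). inv\<^bsub>cyclic_sum l q\<^esub> h \<notin> S i)"

definition Fourier_generic :: "nat \<Rightarrow> ((nat \<Rightarrow> real) \<Rightarrow> real ^ 'd) \<Rightarrow> bool" where
  "Fourier_generic M f \<longleftrightarrow>
     (\<forall>l q a b V s S n \<Delta>.
        l \<ge> 1 \<longrightarrow> (\<forall>j<l. q j \<ge> 2) \<longrightarrow>
        coordinate_decomposition a b V \<longrightarrow> coordinate_permutation a b V s \<longrightarrow>
        admissible l q a b S \<longrightarrow> simplex_face M n \<Delta> \<longrightarrow>
        int n < 2 * int (\<Sum>i<a+b. card (S i))
                - int (\<Sum>i=a..<a+b. card (order_two_part l q (S i)))
                + int (order (cyclic_sum l q)) - 1 \<longrightarrow>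
        \<not> (\<exists>x. (\<forall>g\<in>carrier (cyclic_sum l q). x g \<in> \<Delta>) \<and>
               disjoint_support M (carrier (cyclic_sum l q)) x \<and>
               (\<forall>i<a+b. \<forall>h\<in>S i.
                  fourier_coeff l q (\<lambda>g. sigma_component a s (f (x g)) i) h = 0)))"

(* V is the vertex set of a planar regular r-gon with centre c, circumradius norm u > 0, lying
   in the plane c + span {u, v}. *)
definition regular_polygon :: "nat \<Rightarrow> 'a::real_inner set \<Rightarrow> bool" where
  "regular_polygon r V \<longleftrightarrow>
     r \<ge> 3 \<and>
     (\<exists>c u v. u \<noteq> 0 \<and> norm u = norm v \<and> orthogonal u v \<and>
        V = (\<lambda>k. c + cos (2 * pi * real k / real r) *\<^sub>R u
                   + sin (2 * pi * real k / real r) *\<^sub>R v) ` {..<r})"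

end

theory Submission
  imports
    Defs
    "HOL-Analysis.Complex_Transcendental"
    "HOL-Analysis.Function_Metric"
    "HOL-Number_Theory.Cong"
begin

text \<open>
  Only two frequencies, \<open>0\<close> and \<open>1\<close>, may survive in the Fourier expansion of \<open>g \<mapsto> f (x\<^sub>g)\<close> over
  \<open>\<int>/r\<close>: then \<open>f (x\<^sub>g) = c\<^sub>0 + c\<^sub>1 \<zeta>\<^sup>g\<close> in \<open>\<complex>\<^bsup>(r-1)/2\<^esup>\<close>, a regular \<open>r\<close>-gon unless \<open>c\<^sub>1 = 0\<close>. Such
  points are zeros of an equivariant map from the \<open>r\<close>-fold deleted join of the simplex to
  \<open>\<complex>\<^sup>n\<close>, \<open>2 n = r (r - 1)\<close>, on which \<open>\<int>/r\<close> acts by nontrivial characters: \<open>(r - 1)/2\<close> coordinates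
  make the join parameters equal, \<open>(r - 1)/2\<close> more make the elementary symmetric functions of
  degree \<open>r\<close> of the barycentric coordinates of the \<open>x\<^sub>g\<close> equal (hence zero, as there are too few
  vertices), so that every support has at most \<open>r - 1\<close> points, and the remaining ones are the
  frequencies \<open>2, \<dots>, r - 1\<close> of \<open>f (x\<^sub>g)\<close>. The union of the supports then spans a proper face, and
  Fourier genericity with all nonzero frequencies excludes \<open>c\<^sub>1 = 0\<close>.

  That the equivariant map has a zero is Dold's theorem. Suppose it has none. Coning repeatedly
  gives \<open>2 n\<close>-chains \<open>c\<close> of arbitrarily small tuples of points with \<open>\<partial>c\<close> an orbit sum. Each
  coordinate, by the sector of its argument, labels the points by \<open>\<int>/r\<close> equivariantly, and
  the associated carry cocycle is \<open>0\<close> on small tuples where the coordinate is not small. So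
  the product of the \<open>n\<close> carry cocycles vanishes on \<open>c\<close>; but for every choice of the
  equivariant labels its value on \<open>c\<close> is \<open>1\<close> modulo \<open>r\<close>.
\<close>

section \<open>Chains of small tuples\<close>

text \<open>Alternating sum over the deletions of one entry; deletions inside the tail change sign
  because their positions move up by one.\<close>

primrec coboundary :: "('a list \<Rightarrow> int) \<Rightarrow> 'a list \<Rightarrow> int" where
  "coboundary \<phi> [] = 0"
| "coboundary \<phi> (x # \<sigma>) = \<phi> \<sigma> - coboundary (\<lambda>\<tau>. \<phi> (x # \<tau>)) \<sigma>"

text \<open>Dual of the prism operator: on \<open>[x0, ..., xm]\<close> it is the alternating sum of
  \<open>\<phi>\<close> over \<open>[f x0, ..., f xi, g xi, ..., g xm]\<close>.\<close>

primrec prism :: "('a \<Rightarrow> 'b) \<Rightarrow> ('a \<Rightarrow> 'b) \<Rightarrow> ('b list \<Rightarrow> int) \<Rightarrow> 'a list \<Rightarrow> int" where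
  "prism f g \<phi> [] = 0"
| "prism f g \<phi> (x # \<sigma>) = \<phi> (f x # g x # map g \<sigma>) - prism f g (\<lambda>\<tau>. \<phi> (f x # \<tau>)) \<sigma>"

lemma coboundary_diff:
  "coboundary (\<lambda>\<sigma>. \<phi> \<sigma> - \<psi> \<sigma>) \<sigma> = coboundary \<phi> \<sigma> - coboundary \<psi> \<sigma>"
  by (induction \<sigma> arbitrary: \<phi> \<psi>) auto

lemma coboundary_cmult:
  "coboundary (\<lambda>\<sigma>. c * \<phi> \<sigma>) \<sigma> = c * coboundary \<phi> \<sigma>"
  by (induction \<sigma> arbitrary: \<phi>) (auto simp: algebra_simps)

lemma coboundary_map:
  "coboundary (\<lambda>\<tau>. \<phi> (map f \<tau>)) \<sigma> = coboundary \<phi> (map f \<sigma>)"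
proof (induction \<sigma> arbitrary: \<phi>)
  case (Cons x \<sigma>)
  show ?case
    using Cons[of "\<lambda>\<tau>. \<phi> (f x # \<tau>)"] by simp
qed simp

lemma coboundary_coboundary: "coboundary (coboundary \<phi>) \<sigma> = 0"
  by (induction \<sigma> arbitrary: \<phi>) (auto simp: coboundary_diff)

lemma coboundary_one: "coboundary (\<lambda>_. 1) \<sigma> = (if odd (length \<sigma>) then 1 else 0)"
  by (induction \<sigma>) auto

lemma coboundary_replicate:
  "coboundary \<phi> (replicate (Suc m) v) = (if even m then \<phi> (replicate m v) else 0)"
proof (induction m arbitrary: \<phi>)
  case (Suc m)
  show ?case
    using Suc[of "\<lambda>\<tau>. \<phi> (v # \<tau>)"] by auto
qed simp

lemma prism_add:
  "prism f g (\<lambda>\<sigma>. \<phi> \<sigma> + \<psi> \<sigma>) \<sigma> = prism f g \<phi> \<sigma> + prism f g \<psi> \<sigma>"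
  by (induction \<sigma> arbitrary: \<phi> \<psi>) auto

lemma prism_diff:
  "prism f g (\<lambda>\<sigma>. \<phi> \<sigma> - \<psi> \<sigma>) \<sigma> = prism f g \<phi> \<sigma> - prism f g \<psi> \<sigma>"
  by (induction \<sigma> arbitrary: \<phi> \<psi>) auto

lemma prism_cong:
  assumes "\<And>\<tau>. \<lbrakk>set \<tau> \<subseteq> f ` set \<sigma> \<union> g ` set \<sigma>; length \<tau> = Suc (length \<sigma>)\<rbrakk> \<Longrightarrow> \<phi> \<tau> = \<psi> \<tau>"
  shows "prism f g \<phi> \<sigma> = prism f g \<psi> \<sigma>"
  using assms
proof (induction \<sigma> arbitrary: \<phi> \<psi>)
  case (Cons x \<sigma>)
  have "prism f g (\<lambda>\<tau>. \<phi> (f x # \<tau>)) \<sigma> = prism f g (\<lambda>\<tau>. \<psi> (f x # \<tau>)) \<sigma>"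
    by (rule Cons.IH, rule Cons.prems) auto
  moreover have "\<phi> (f x # g x # map g \<sigma>) = \<psi> (f x # g x # map g \<sigma>)"
    by (rule Cons.prems) auto
  ultimately show ?case by simp
qed simp

text \<open>The chain homotopy between \<open>map f\<close> and \<open>map g\<close> in dual form.
  Splitting off the first entry, the faces that drop a later entry match by
  \<open>coboundary_map\<close>, and the remaining mixed terms cancel.\<close>

lemma prism_homotopy:
  "coboundary (prism f g \<phi>) \<sigma> + prism f g (coboundary \<phi>) \<sigma> = \<phi> (map g \<sigma>) - \<phi> (map f \<sigma>)"
proof (induction \<sigma> arbitrary: \<phi>)
  case (Cons x \<sigma>)
  show ?case
    using Cons[of "\<lambda>\<tau>. \<phi> (f x # \<tau>)"] coboundary_map[of "\<lambda>\<tau>. \<phi> (f x # g x # \<tau>)" g \<sigma>]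
    by (simp add: coboundary_diff prism_diff)
qed simp

text \<open>Entries may repeat, and \<open>m\<close> counts them, so the dimension as a simplex is
  \<open>m - 1\<close>.\<close>

definition small_tuple :: "'a::metric_space set \<Rightarrow> real \<Rightarrow> nat \<Rightarrow> 'a list \<Rightarrow> bool" where
  "small_tuple X \<epsilon> m \<sigma> \<longleftrightarrow>
     set \<sigma> \<subseteq> X \<and> length \<sigma> = m \<and> (\<forall>x\<in>set \<sigma>. \<forall>y\<in>set \<sigma>. dist x y < \<epsilon>)"

text \<open>A chain is encoded by its pairing with integer cochains, which are arbitrary functions on
  tuples; thus \<open>J\<close> has boundary \<open>I\<close> when \<open>J (coboundary \<phi>) = I \<phi>\<close> for all \<open>\<phi>\<close>. The coboundary is
  augmented: a \<open>0\<close>-chain is a cycle only if its coefficients sum to \<open>0\<close>.\<close>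

definition chain :: "'a::metric_space set \<Rightarrow> real \<Rightarrow> nat \<Rightarrow> (('a list \<Rightarrow> int) \<Rightarrow> int) \<Rightarrow> bool" where
  "chain X \<epsilon> m I \<longleftrightarrow>
     (\<forall>\<phi> \<psi>. I (\<lambda>\<sigma>. \<phi> \<sigma> + \<psi> \<sigma>) = I \<phi> + I \<psi>) \<and>
     (\<forall>\<phi> \<psi>. (\<forall>\<sigma>. small_tuple X \<epsilon> m \<sigma> \<longrightarrow> \<phi> \<sigma> = \<psi> \<sigma>) \<longrightarrow> I \<phi> = I \<psi>)"

lemma chain_add: "chain X \<epsilon> m I \<Longrightarrow> I (\<lambda>\<sigma>. \<phi> \<sigma> + \<psi> \<sigma>) = I \<phi> + I \<psi>"
  by (simp add: chain_def)

lemma chain_cong: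
  "chain X \<epsilon> m I \<Longrightarrow> (\<And>\<sigma>. small_tuple X \<epsilon> m \<sigma> \<Longrightarrow> \<phi> \<sigma> = \<psi> \<sigma>) \<Longrightarrow> I \<phi> = I \<psi>"
  by (simp add: chain_def)

lemma chain_zero: "chain X \<epsilon> m I \<Longrightarrow> I (\<lambda>_. 0) = 0"
  using chain_add[of X \<epsilon> m I "\<lambda>_. 0" "\<lambda>_. 0"] by simp

lemma chain_minus: "chain X \<epsilon> m I \<Longrightarrow> I (\<lambda>\<sigma>. - \<phi> \<sigma>) = - I \<phi>"
  using chain_add[of X \<epsilon> m I \<phi> "\<lambda>\<sigma>. - \<phi> \<sigma>"] chain_zero[of X \<epsilon> m I] by simp

lemma chain_diff: "chain X \<epsilon> m I \<Longrightarrow> I (\<lambda>\<sigma>. \<phi> \<sigma> - \<psi> \<sigma>) = I \<phi> - I \<psi>"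
  using chain_add[of X \<epsilon> m I \<phi> "\<lambda>\<sigma>. - \<psi> \<sigma>"] chain_minus[of X \<epsilon> m I \<psi>] by simp

lemma chain_sum:
  assumes "chain X \<epsilon> m I" "finite A"
  shows "I (\<lambda>\<sigma>. \<Sum>i\<in>A. \<phi> i \<sigma>) = (\<Sum>i\<in>A. I (\<phi> i))"
  using assms(2) by (induction A) (auto simp: chain_zero[OF assms(1)] chain_add[OF assms(1)])

lemma chain_cmult:
  assumes "chain X \<epsilon> m I"
  shows "I (\<lambda>\<sigma>. c * \<phi> \<sigma>) = c * I \<phi>"
proof -
  have nat: "I (\<lambda>\<sigma>. int n * \<phi> \<sigma>) = int n * I \<phi>" for n
    by (induction n) (auto simp: chain_zero[OF assms] chain_add[OF assms] algebra_simps)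
  show ?thesis
  proof (cases "c \<ge> 0")
    case True
    then show ?thesis using nat[of "nat c"] by simp
  next
    case False
    then show ?thesis
      using nat[of "nat (- c)"] chain_minus[OF assms, of "\<lambda>\<sigma>. c * \<phi> \<sigma>"] by simp
  qed
qed

lemma chain_mono:
  assumes "chain X \<epsilon> m I" "X \<subseteq> Y" "\<epsilon> \<le> \<epsilon>'"
  shows "chain Y \<epsilon>' m I"
proof -
  have "small_tuple X \<epsilon> m \<sigma> \<Longrightarrow> small_tuple Y \<epsilon>' m \<sigma>" for \<sigma>
    using assms(2,3) unfolding small_tuple_def by fastforce
  then show ?thesis
    using assms(1) unfolding chain_def by blast
qed

lemma chain_pullback:
  assumes "chain X \<delta> m I"
    and "\<And>x. x \<in> X \<Longrightarrow> f x \<in> Y"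
    and "\<And>x y. \<lbrakk>x \<in> X; y \<in> X; dist x y < \<delta>\<rbrakk> \<Longrightarrow> dist (f x) (f y) < \<epsilon>"
  shows "chain Y \<epsilon> m (\<lambda>\<phi>. I (\<lambda>\<sigma>. \<phi> (map f \<sigma>)))"
proof -
  have small: "small_tuple X \<delta> m \<sigma> \<Longrightarrow> small_tuple Y \<epsilon> m (map f \<sigma>)" for \<sigma>
    using assms(2,3) unfolding small_tuple_def by (auto simp: subset_eq)
  show ?thesis
    unfolding chain_def
    by (auto intro!: chain_cong[OF assms(1)] simp: chain_add[OF assms(1)] dest!: small)
qed

text \<open>A contraction of \<open>X\<close> inside \<open>Y\<close> fills cycles. It is cut into
  time steps so short that the prisms over small tuples are small in \<open>Y\<close>; they
  telescope to a chain from the cycle to a multiple of a constant tuple. The bound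
  \<open>\<delta>\<close> is chosen before the cycle and its dimension.\<close>

lemma chain_cone:
  fixes X Y :: "'a::metric_space set" and H :: "real \<times> 'a \<Rightarrow> 'a"
  assumes cpt: "compact X" and "X \<subseteq> Y" and "\<epsilon> > 0"
    and H: "continuous_on ({0..1} \<times> X) H" "H ` ({0..1} \<times> X) \<subseteq> Y"
    and H0: "\<And>x. x \<in> X \<Longrightarrow> H (0, x) = x" and H1: "\<And>x. x \<in> X \<Longrightarrow> H (1, x) = v"
    and "v \<in> Y"
  obtains \<delta> where "\<delta> > 0"
    "\<And>I m. chain X \<delta> m I \<Longrightarrow> (\<And>\<phi>. I (coboundary \<phi>) = 0) \<Longrightarrow>
       \<exists>J. chain Y \<epsilon> (Suc m) J \<and> (\<forall>\<phi>. J (coboundary \<phi>) = I \<phi>)"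
proof -
  have "uniformly_continuous_on ({0..1} \<times> X) H"
    by (intro compact_uniformly_continuous H compact_Times cpt) auto
  then obtain \<eta> where \<eta>: "\<eta> > 0"
    "\<And>s t x y. \<lbrakk>s \<in> {0..1}; t \<in> {0..1}; x \<in> X; y \<in> X; dist (s, x) (t, y) < \<eta>\<rbrakk>
       \<Longrightarrow> dist (H (s, x)) (H (t, y)) < \<epsilon>"
    unfolding uniformly_continuous_on_def using \<open>\<epsilon> > 0\<close>
    by (metis (no_types, lifting) SigmaI)
  \<comment> \<open>Half of \<open>\<eta>\<close> is reserved for the step in time, half for the
    diameter of the tuple.\<close>
  obtain L where L: "L > 0" "1 / real L < \<eta> / 2"
    using \<eta>(1) by (metis half_gt_zero nat_approx_posE of_nat_0_less_iff zero_less_Suc)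
  have near: "dist (H (s, x)) (H (t, y)) < \<epsilon>"
    if "s \<in> {0..1}" "t \<in> {0..1}" "x \<in> X" "y \<in> X" "dist x y < \<eta> / 2" "\<bar>s - t\<bar> \<le> 1 / real L"
    for s t x y
  proof (rule \<eta>(2))
    have "dist (s, x) (t, y) \<le> dist s t + dist x y"
      by (simp add: dist_Pair_Pair sqrt_sum_squares_le_sum)
    also have "\<dots> < \<eta>" using that L by (simp add: dist_real_def)
    finally show "dist (s, x) (t, y) < \<eta>" .
  qed (use that in auto)
  have "\<exists>J. chain Y \<epsilon> (Suc m) J \<and> (\<forall>\<phi>. J (coboundary \<phi>) = I \<phi>)"
    if I: "chain X (\<eta> / 2) m I" and cycle: "\<And>\<phi>. I (coboundary \<phi>) = 0" for I m
  proof -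
    define h where "h i = (\<lambda>x. H (real i / real L, x))" for i
    \<comment> \<open>At time 1 the cycle has become \<open>I (\<lambda>_. 1)\<close> copies of the
      constant tuple at \<open>v\<close>. For even \<open>m\<close> that tuple is the boundary of
      the one with \<open>m + 1\<close> entries, which the first summand adds; for odd
      \<open>m\<close> the multiplicity is 0.\<close>
    define J where "J \<phi> = I (\<lambda>_. 1) * \<phi> (replicate (Suc m) v)
       - (\<Sum>i<L. I (prism (h i) (h (Suc i)) \<phi>))" for \<phi>
    \<comment> \<open>On tuples of odd length the constant cochain 1 is its own coboundary.\<close>
    have I1: "I (\<lambda>_. 1) = 0" if "odd m"
    proof -
      have "I (\<lambda>_. 1) = I (coboundary (\<lambda>_. 1))"
        by (rule chain_cong[OF I]) (use that in \<open>auto simp: coboundary_one small_tuple_def\<close>)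
      then show ?thesis using cycle by simp
    qed
    have Icong: "I (prism (h i) (h (Suc i)) \<phi>) = I (prism (h i) (h (Suc i)) \<psi>)"
      if "i < L" and eq: "\<And>\<sigma>. small_tuple Y \<epsilon> (Suc m) \<sigma> \<Longrightarrow> \<phi> \<sigma> = \<psi> \<sigma>" for i \<phi> \<psi>
    proof (rule chain_cong[OF I], rule prism_cong)
      fix \<sigma> \<tau> assume \<sigma>: "small_tuple X (\<eta> / 2) m \<sigma>"
        and \<tau>: "set \<tau> \<subseteq> h i ` set \<sigma> \<union> h (Suc i) ` set \<sigma>" "length \<tau> = Suc (length \<sigma>)"
      have times: "\<exists>j x. z = h j x \<and> (j = i \<or> j = Suc i) \<and> x \<in> set \<sigma>" if "z \<in> set \<tau>" for z
        using that \<tau>(1) by blast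
      have unit: "real j / real L \<in> {0..1}" if "j = i \<or> j = Suc i" for j
        using that \<open>i < L\<close> by (auto simp: divide_simps)
      have "small_tuple Y \<epsilon> (Suc m) \<tau>"
        unfolding small_tuple_def
      proof (intro conjI ballI)
        show "set \<tau> \<subseteq> Y"
        proof
          fix z assume "z \<in> set \<tau>"
          then obtain j x where "z = h j x" "j = i \<or> j = Suc i" "x \<in> set \<sigma>"
            using times by blast
          then show "z \<in> Y"
            using H(2) unit[of j] \<sigma> unfolding h_def small_tuple_def by blast
        qed
        show "length \<tau> = Suc m" using \<tau> \<sigma> by (simp add: small_tuple_def)
        fix z w assume "z \<in> set \<tau>" "w \<in> set \<tau>"
        then obtain j x k y where *: "z = h j x" "j = i \<or> j = Suc i" "x \<in> set \<sigma>"
            "w = h k y" "k = i \<or> k = Suc i" "y \<in> set \<sigma>"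
          using times by meson
        have "\<bar>real j / real L - real k / real L\<bar> \<le> 1 / real L"
          using * L by (auto simp: divide_simps)
        then show "dist z w < \<epsilon>"
          using near[of "real j / real L" "real k / real L" x y] * unit \<sigma>
          by (auto simp: h_def small_tuple_def)
      qed
      then show "\<phi> \<tau> = \<psi> \<tau>" by (rule eq)
    qed
    have v: "small_tuple Y \<epsilon> (Suc m) (replicate (Suc m) v)"
      using \<open>v \<in> Y\<close> \<open>\<epsilon> > 0\<close> by (auto simp: small_tuple_def)
    have "chain Y \<epsilon> (Suc m) J"
      unfolding chain_def
    proof (intro conjI allI impI)
      fix \<phi> \<psi> :: "'a list \<Rightarrow> int"
      have "prism (h i) (h (Suc i)) (\<lambda>\<sigma>. \<phi> \<sigma> + \<psi> \<sigma>) =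
          (\<lambda>\<sigma>. prism (h i) (h (Suc i)) \<phi> \<sigma> + prism (h i) (h (Suc i)) \<psi> \<sigma>)" for i
        by (auto simp: prism_add)
      then show "J (\<lambda>\<sigma>. \<phi> \<sigma> + \<psi> \<sigma>) = J \<phi> + J \<psi>"
        by (simp add: J_def chain_add[OF I] sum.distrib algebra_simps)
    next
      fix \<phi> \<psi> :: "'a list \<Rightarrow> int"
      assume eq: "\<forall>\<sigma>. small_tuple Y \<epsilon> (Suc m) \<sigma> \<longrightarrow> \<phi> \<sigma> = \<psi> \<sigma>"
      have "(\<Sum>i<L. I (prism (h i) (h (Suc i)) \<phi>)) = (\<Sum>i<L. I (prism (h i) (h (Suc i)) \<psi>))"
        by (rule sum.cong[OF refl], rule Icong) (use eq in auto)
      moreover have "\<phi> (replicate (Suc m) v) = \<psi> (replicate (Suc m) v)"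
        using eq v by blast
      ultimately show "J \<phi> = J \<psi>"
        by (simp add: J_def del: replicate_Suc)
    qed
    moreover have "J (coboundary \<phi>) = I \<phi>" for \<phi>
    proof -
      have step: "I (prism (h i) (h (Suc i)) (coboundary \<phi>)) =
          I (\<lambda>\<sigma>. \<phi> (map (h (Suc i)) \<sigma>)) - I (\<lambda>\<sigma>. \<phi> (map (h i) \<sigma>))" for i
      proof -
        have "prism (h i) (h (Suc i)) (coboundary \<phi>) = (\<lambda>\<sigma>. (\<phi> (map (h (Suc i)) \<sigma>)
            - \<phi> (map (h i) \<sigma>)) - coboundary (prism (h i) (h (Suc i)) \<phi>) \<sigma>)"
          using prism_homotopy[of "h i" "h (Suc i)" \<phi>] by (auto simp: algebra_simps)
        then show ?thesis
          by (simp add: chain_diff[OF I] cycle)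
      qed
      have "(\<Sum>i<L. I (prism (h i) (h (Suc i)) (coboundary \<phi>))) =
          I (\<lambda>\<sigma>. \<phi> (map (h L) \<sigma>)) - I (\<lambda>\<sigma>. \<phi> (map (h 0) \<sigma>))"
        unfolding step by (rule sum_lessThan_telescope)
      moreover have "I (\<lambda>\<sigma>. \<phi> (map (h 0) \<sigma>)) = I \<phi>"
      proof (rule chain_cong[OF I])
        fix \<sigma> assume "small_tuple X (\<eta> / 2) m \<sigma>"
        then have "map (h 0) \<sigma> = \<sigma>"
          using H0 by (intro map_idI) (auto simp: h_def small_tuple_def)
        then show "\<phi> (map (h 0) \<sigma>) = \<phi> \<sigma>" by simp
      qed
      moreover have "I (\<lambda>\<sigma>. \<phi> (map (h L) \<sigma>)) = I (\<lambda>\<sigma>. \<phi> (replicate m v) * 1)"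
      proof (rule chain_cong[OF I])
        fix \<sigma> assume \<sigma>: "small_tuple X (\<eta> / 2) m \<sigma>"
        then have "map (h L) \<sigma> = map (\<lambda>_. v) \<sigma>"
          using H1 L by (intro map_cong) (auto simp: h_def small_tuple_def)
        also have "\<dots> = replicate m v"
          using \<sigma> by (simp add: small_tuple_def map_replicate_const)
        finally show "\<phi> (map (h L) \<sigma>) = \<phi> (replicate m v) * 1" by simp
      qed
      ultimately show ?thesis
        using I1 by (auto simp: J_def chain_cmult[OF I, of _ "\<lambda>_. 1"] coboundary_replicate
            simp del: replicate_Suc coboundary.simps mult_1_right)
    qed
    ultimately show ?thesis by blast
  qed
  then show ?thesis
    using \<eta>(1) that[of "\<eta> / 2"] by simp
qed

section \<open>Equivariant labellings and carry cocycles\<close>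

lemma coboundary_map_fun:
  "coboundary (\<lambda>\<tau>. \<phi> (map f \<tau>)) = (\<lambda>\<sigma>. coboundary \<phi> (map f \<sigma>))"
  by (simp add: fun_eq_iff coboundary_map)

lemma coboundary_cong:
  assumes "\<And>\<tau>. Suc (length \<tau>) = length \<sigma> \<Longrightarrow> \<phi> \<tau> = \<psi> \<tau>"
  shows "coboundary \<phi> \<sigma> = coboundary \<psi> \<sigma>"
  using assms
proof (induction \<sigma> arbitrary: \<phi> \<psi>)
  case (Cons x \<sigma>)
  have "coboundary (\<lambda>\<tau>. \<phi> (x # \<tau>)) \<sigma> = coboundary (\<lambda>\<tau>. \<psi> (x # \<tau>)) \<sigma>"
    by (rule Cons.IH, rule Cons.prems) simp
  then show ?case using Cons.prems by simp
qed simp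

lemma chain_diff_chain:
  assumes "chain X \<epsilon> m I" "chain X \<epsilon> m J"
  shows "chain X \<epsilon> m (\<lambda>\<phi>. I \<phi> - J \<phi>)"
  using assms unfolding chain_def by (auto simp: algebra_simps) metis

lemma chain_sum_chain:
  assumes "\<And>i. i \<in> A \<Longrightarrow> chain X \<epsilon> m (I i)"
  shows "chain X \<epsilon> m (\<lambda>\<phi>. \<Sum>i\<in>A. I i \<phi>)"
proof -
  have "(\<Sum>i\<in>A. I i (\<lambda>\<sigma>. \<phi> \<sigma> + \<psi> \<sigma>)) = (\<Sum>i\<in>A. I i \<phi>) + (\<Sum>i\<in>A. I i \<psi>)" for \<phi> \<psi>
    unfolding sum.distrib[symmetric] by (rule sum.cong[OF refl], rule chain_add, rule assms)
  moreover have "(\<Sum>i\<in>A. I i \<phi>) = (\<Sum>i\<in>A. I i \<psi>)"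
    if "\<And>\<sigma>. small_tuple X \<epsilon> m \<sigma> \<Longrightarrow> \<phi> \<sigma> = \<psi> \<sigma>" for \<phi> \<psi>
    by (rule sum.cong[OF refl], rule chain_cong, rule assms) (use that in auto)
  ultimately show ?thesis unfolding chain_def by blast
qed

section \<open>Carry cocycles and their cup products\<close>

text \<open>The number of times \<open>p\<close> must be added to the difference of two labels to
  reach its representative \<open>centered\<close>, which for odd \<open>p\<close> is the one of
  least absolute value.\<close>

definition wrap :: "int \<Rightarrow> ('a \<Rightarrow> int) \<Rightarrow> 'a \<Rightarrow> 'a \<Rightarrow> int" where
  "wrap p a x y = - ((a y - a x + p div 2) div p)"

definition centered :: "int \<Rightarrow> ('a \<Rightarrow> int) \<Rightarrow> 'a \<Rightarrow> 'a \<Rightarrow> int" where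
  "centered p a x y = (a y - a x + p div 2) mod p - p div 2"

text \<open>The coboundary of \<open>wrap\<close>. Since \<open>p * carry\<close> is the coboundary
  of \<open>centered\<close>, this is the integral Bockstein of the class modulo \<open>p\<close>
  given by the differences of labels, and only these differences modulo \<open>p\<close>
  matter.\<close>

definition carry :: "int \<Rightarrow> ('a \<Rightarrow> int) \<Rightarrow> 'a \<Rightarrow> 'a \<Rightarrow> 'a \<Rightarrow> int" where
  "carry p a x y z = wrap p a x y + wrap p a y z - wrap p a x z"

text \<open>Alexander-Whitney product of carry cocycles: each factor has degree 2 and its last
  vertex is the first of the next factor, so \<open>n\<close> factors take \<open>2 * n + 1\<close>
  entries.\<close>

fun cup :: "int \<Rightarrow> ('a \<Rightarrow> int) list \<Rightarrow> 'a list \<Rightarrow> int" where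
  "cup p [] \<sigma> = 1"
| "cup p (a # as) (x # y # z # \<tau>) = carry p a x y z * cup p as (z # \<tau>)"
| "cup p (a # as) _ = 0"

lemma centered_eq_wrap: "centered p a x y = a y - a x + p * wrap p a x y"
  unfolding centered_def wrap_def using mult_div_mod_eq[of p "a y - a x + p div 2"]
  by (simp add: algebra_simps)

lemma carry_eq_centered:
  "p * carry p a x y z = centered p a x y + centered p a y z - centered p a x z"
  by (simp add: carry_def centered_eq_wrap algebra_simps)

lemma centered_cong:
  assumes "(a y - a x) mod p = (b y' - b x') mod p"
  shows "centered p a x y = centered p b x' y'"
proof -
  have "(a y - a x + p div 2) mod p = (b y' - b x' + p div 2) mod p"
    using assms by (metis mod_add_left_eq)
  then show ?thesis by (simp add: centered_def)
qed

text \<open>Leibniz rule for the product of a 1-cochain \<open>u\<close> with a cocycle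
  \<open>\<psi>\<close>: the term with the coboundary of \<open>\<psi>\<close> drops out.\<close>

lemma coboundary_cup_wrap:
  assumes "coboundary \<psi> (y # z # \<tau>) = 0"
  shows "coboundary (\<lambda>\<sigma>. u (hd \<sigma>) (hd (tl \<sigma>)) * \<psi> (tl \<sigma>)) (x # y # z # \<tau>) =
    (u x y + u y z - u x z) * \<psi> (z # \<tau>)"
proof -
  have "coboundary (\<lambda>\<tau>. \<psi> (y # z # \<tau>)) \<tau> = \<psi> (y # \<tau>) - \<psi> (z # \<tau>)"
    using assms by simp
  then have "c * coboundary (\<lambda>\<tau>. \<psi> (y # z # \<tau>)) \<tau> = c * (\<psi> (y # \<tau>) - \<psi> (z # \<tau>))" for c
    by simp
  then show ?thesis by (simp add: coboundary_cmult right_diff_distrib left_diff_distrib distrib_right)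
qed

text \<open>The same Leibniz rule for the 0-cochain \<open>a\<close>.\<close>

lemma coboundary_cup_label:
  assumes "coboundary \<psi> (x # y # \<tau>) = 0"
  shows "coboundary (\<lambda>\<sigma>. a (hd \<sigma>) * \<psi> \<sigma>) (x # y # \<tau>) = (a y - a x) * \<psi> (y # \<tau>)"
proof -
  have "coboundary (\<lambda>\<tau>. \<psi> (x # y # \<tau>)) \<tau> = \<psi> (x # \<tau>) - \<psi> (y # \<tau>)"
    using assms by simp
  then have "c * coboundary (\<lambda>\<tau>. \<psi> (x # y # \<tau>)) \<tau> = c * (\<psi> (x # \<tau>) - \<psi> (y # \<tau>))" for c
    by simp
  then show ?thesis by (simp add: coboundary_cmult right_diff_distrib left_diff_distrib distrib_right)
qed

lemma length_eq_SucSuc: 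
  "length \<sigma> = Suc (Suc m) \<Longrightarrow> \<exists>x y \<tau>. \<sigma> = x # y # \<tau> \<and> length \<tau> = m"
  by (cases \<sigma>; cases "tl \<sigma>") auto

lemma length_eq_SucSucSuc: 
  "length \<sigma> = Suc (Suc (Suc m)) \<Longrightarrow> \<exists>x y z \<tau>. \<sigma> = x # y # z # \<tau> \<and> length \<tau> = m"
  by (cases \<sigma>; cases "tl \<sigma>"; cases "tl (tl \<sigma>)") auto

text \<open>As \<open>carry\<close> is the coboundary of \<open>wrap\<close>, the product is exact.
  What survives equivariantly comes from \<open>wrap\<close>, unlike \<open>carry\<close>, not being
  invariant under a cyclic shift of the labels.\<close>

lemma cup_Cons_eq_coboundary:
  assumes "\<And>\<sigma>. length \<sigma> = Suc (Suc m) \<Longrightarrow> coboundary (cup p as) \<sigma> = 0"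
    and "length \<sigma> = Suc (Suc (Suc m))"
  shows "cup p (a # as) \<sigma> =
    coboundary (\<lambda>\<sigma>. wrap p a (hd \<sigma>) (hd (tl \<sigma>)) * cup p as (tl \<sigma>)) \<sigma>"
proof -
  obtain x y z \<tau> where \<sigma>: "\<sigma> = x # y # z # \<tau>" "length \<tau> = m"
    using length_eq_SucSucSuc[OF assms(2)] by blast
  have "coboundary (cup p as) (y # z # \<tau>) = 0" by (rule assms) (simp add: \<sigma>)
  from coboundary_cup_wrap[OF this, of "wrap p a" x] show ?thesis
    unfolding \<sigma> cup.simps carry_def by simp
qed

lemma coboundary_cup:
  "length \<sigma> = 2 * length as + 2 \<Longrightarrow> coboundary (cup p as) \<sigma> = 0"
proof (induction as arbitrary: \<sigma>)
  case Nil
  then show ?case using coboundary_one[of \<sigma>] by (simp add: fun_eq_iff cong: coboundary_cong)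
next
  case (Cons a as)
  have "coboundary (cup p (a # as)) \<sigma> = coboundary (coboundary
      (\<lambda>\<sigma>. wrap p a (hd \<sigma>) (hd (tl \<sigma>)) * cup p as (tl \<sigma>))) \<sigma>"
    by (rule coboundary_cong, rule cup_Cons_eq_coboundary[where m = "2 * length as"])
      (use Cons in auto)
  then show ?case by (simp add: coboundary_coboundary)
qed

lemma cup_eq_zero:
  assumes "a \<in> set as" "\<And>x y z. {x, y, z} \<subseteq> set \<sigma> \<Longrightarrow> carry p a x y z = 0"
    and "length \<sigma> = 2 * length as + 1"
  shows "cup p as \<sigma> = 0"
  using assms
proof (induction as arbitrary: \<sigma>)
  case (Cons b as)
  obtain x y z \<tau> where \<sigma>: "\<sigma> = x # y # z # \<tau>" "length \<tau> = 2 * length as"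
    using length_eq_SucSucSuc[of \<sigma> "2 * length as"] Cons.prems by auto
  show ?case
  proof (cases "b = a")
    case True
    then show ?thesis using Cons.prems(2)[of x y z] \<sigma> by simp
  next
    case False
    then have "cup p as (z # \<tau>) = 0"
      using Cons.prems \<sigma> by (intro Cons.IH) auto
    then show ?thesis using \<sigma> by simp
  qed
qed simp

lemma bij_betw_add_mod:
  fixes c p :: nat
  assumes "c < p"
  shows "bij_betw (\<lambda>i. (c + i) mod p) {..<p} {..<p}"
proof -
  have "inj_on (\<lambda>i. (c + i) mod p) {..<p}"
    using assms by (intro inj_onI) (auto simp: mod_if split: if_splits)
  moreover have "(\<lambda>i. (c + i) mod p) ` {..<p} \<subseteq> {..<p}"
    using assms by auto
  ultimately show ?thesis
    unfolding bij_betw_def using endo_inj_surj[OF finite_lessThan] by blast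
qed

section \<open>Contractible towers with an action of Z/p\<close>

text \<open>A stand-in for high connectivity: through \<open>chain_cone\<close>, cycles of
  sufficiently small tuples in \<open>X k\<close> bound in \<open>X (Suc k)\<close>. The
  contractions need not commute with \<open>T\<close>.\<close>

locale contractible_tower =
  fixes X :: "nat \<Rightarrow> 'a::metric_space set" and T :: "'a \<Rightarrow> 'a" and p :: nat
    and H :: "nat \<Rightarrow> real \<times> 'a \<Rightarrow> 'a" and v :: "nat \<Rightarrow> 'a"
  assumes p_odd: "odd p" and p_ge_3: "p \<ge> 3"
    and compact_X: "compact (X k)"
    and continuous_T: "continuous_on (X k) T"
    and T_X: "x \<in> X k \<Longrightarrow> T x \<in> X k"
    and T_pow: "x \<in> X k \<Longrightarrow> (T ^^ p) x = x"
    and X_Suc: "X k \<subseteq> X (Suc k)"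
    and X_nonempty: "X 0 \<noteq> {}"
    and continuous_H: "continuous_on ({0..1} \<times> X k) (H k)"
    and H_image: "H k ` ({0..1} \<times> X k) \<subseteq> X (Suc k)"
    and H_0: "x \<in> X k \<Longrightarrow> H k (0, x) = x"
    and H_1: "x \<in> X k \<Longrightarrow> H k (1, x) = v k"
    and v_in: "v k \<in> X (Suc k)"
begin

text \<open>An equivariant map to Z/p, written with the representatives
  \<open>0, ..., p - 1\<close>. No continuity is asked for: cochains are arbitrary
  functions.\<close>

definition labelling :: "nat \<Rightarrow> ('a \<Rightarrow> int) \<Rightarrow> bool" where
  "labelling k a \<longleftrightarrow> (\<forall>x\<in>X k. a x \<in> {0..<int p} \<and> a (T x) = (a x + 1) mod int p)"

lemma labelling_Suc: "labelling (Suc k) a \<Longrightarrow> labelling k a"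
  using X_Suc unfolding labelling_def by blast

lemma T_funpow_X: "x \<in> X k \<Longrightarrow> (T ^^ i) x \<in> X k"
  by (induction i) (auto intro: T_X)

lemma continuous_T_funpow: "continuous_on (X k) (T ^^ i)"
proof (induction i)
  case (Suc i)
  have "continuous_on (X k) (T \<circ> (T ^^ i))"
    by (rule continuous_on_compose[OF Suc continuous_on_subset[OF continuous_T]])
      (use T_funpow_X in auto)
  then show ?case by simp
qed (simp add: continuous_on_id id_def)

lemma T_funpow_small:
  assumes "\<epsilon> > 0"
  obtains \<delta> where "\<delta> > 0"
    "\<And>i x y. \<lbrakk>i < n; x \<in> X k; y \<in> X k; dist x y < \<delta>\<rbrakk> \<Longrightarrow> dist ((T ^^ i) x) ((T ^^ i) y) < \<epsilon>"
proof -
  have "\<exists>\<delta>>0. \<forall>x\<in>X k. \<forall>y\<in>X k. dist x y < \<delta> \<longrightarrow> dist ((T ^^ i) x) ((T ^^ i) y) < \<epsilon>" for i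
  proof -
    have "uniformly_continuous_on (X k) (T ^^ i)"
      by (rule compact_uniformly_continuous[OF continuous_T_funpow compact_X])
    then show ?thesis
      unfolding uniformly_continuous_on_def using assms by (metis dist_commute)
  qed
  then obtain d where d: "\<And>i. d i > 0"
    "\<And>i x y. \<lbrakk>x \<in> X k; y \<in> X k; dist x y < d i\<rbrakk> \<Longrightarrow> dist ((T ^^ i) x) ((T ^^ i) y) < \<epsilon>"
    by metis
  show ?thesis
  proof (rule that)
    \<comment> \<open>The extra 1 keeps the minimum defined for \<open>n = 0\<close>.\<close>
    show "Min (insert 1 (d ` {..<n})) > 0" using d(1) by auto
    fix i x y assume "i < n" "x \<in> X k" "y \<in> X k" "dist x y < Min (insert 1 (d ` {..<n}))"
    then show "dist ((T ^^ i) x) ((T ^^ i) y) < \<epsilon>" by (intro d(2)) auto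
  qed
qed

lemma labelling_T_funpow:
  assumes "labelling k a" "x \<in> X k"
  shows "a ((T ^^ i) x) = (a x + int i) mod int p"
proof (induction i)
  case 0
  then show ?case using assms by (simp add: labelling_def)
next
  case (Suc i)
  have "a ((T ^^ Suc i) x) = (a ((T ^^ i) x) + 1) mod int p"
    using assms T_funpow_X[OF assms(2), of i] by (simp add: labelling_def)
  then show ?case
    by (simp only: Suc mod_add_left_eq) (simp add: algebra_simps)
qed

lemma centered_T:
  assumes "labelling k a" "x \<in> X k" "y \<in> X k"
  shows "centered (int p) a ((T ^^ i) x) ((T ^^ i) y) = centered (int p) a x y"
  by (rule centered_cong) (simp add: labelling_T_funpow[OF assms(1)] assms(2,3) mod_diff_eq)

text \<open>\<open>p * carry\<close> is a combination of values of \<open>centered\<close>, which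
  are invariant because \<open>T\<close> moves all labels by the same amount modulo
  \<open>p\<close>.\<close>

lemma carry_T:
  assumes "labelling k a" "x \<in> X k" "y \<in> X k" "z \<in> X k"
  shows "carry (int p) a ((T ^^ i) x) ((T ^^ i) y) ((T ^^ i) z) = carry (int p) a x y z"
proof -
  have "int p * carry (int p) a ((T ^^ i) x) ((T ^^ i) y) ((T ^^ i) z) = int p * carry (int p) a x y z"
    unfolding carry_eq_centered using centered_T[OF assms(1)] assms by simp
  then show ?thesis using p_ge_3 by simp
qed

lemma cup_T:
  assumes "\<forall>a\<in>set as. labelling k a" "set \<sigma> \<subseteq> X k"
  shows "cup (int p) as (map (T ^^ i) \<sigma>) = cup (int p) as \<sigma>"
  using assms
proof (induction "int p" as \<sigma> rule: cup.induct)
  case (2 a as x y z \<tau>)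
  then show ?case using carry_T[of k a x y z i] by simp
qed auto

text \<open>Along an orbit every label occurs exactly once.\<close>

lemma sum_label_orbit:
  assumes "labelling k a" "x \<in> X k"
  shows "(\<Sum>i<p. a ((T ^^ i) x)) = (\<Sum>i<p. int i)"
proof -
  have ax: "a x \<in> {0..<int p}" using assms by (simp add: labelling_def)
  define c where "c = nat (a x)"
  have c: "a x = int c" "c < p" using ax by (auto simp: c_def)
  have "(\<Sum>i<p. int ((c + i) mod p)) = (\<Sum>i<p. int i)"
    by (rule sum.reindex_bij_betw[OF bij_betw_add_mod[OF c(2)]])
  then show ?thesis
    by (simp add: labelling_T_funpow[OF assms] c zmod_int)
qed

text \<open>Multiplied by \<open>p\<close>, the sum consists of \<open>p\<close> equal values of
  \<open>centered\<close> and the difference of the label sums of two orbits, which is 0 by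
  \<open>sum_label_orbit\<close>.\<close>

lemma sum_wrap_orbit:
  assumes "labelling k a" "x \<in> X k" "y \<in> X k"
  shows "(\<Sum>i<p. wrap (int p) a ((T ^^ i) x) ((T ^^ i) y)) = centered (int p) a x y"
proof -
  have "int p * (\<Sum>i<p. wrap (int p) a ((T ^^ i) x) ((T ^^ i) y)) =
      (\<Sum>i<p. centered (int p) a ((T ^^ i) x) ((T ^^ i) y)
        + a ((T ^^ i) x) - a ((T ^^ i) y))"
    unfolding sum_distrib_left by (rule sum.cong) (auto simp: centered_eq_wrap)
  also have "\<dots> = (\<Sum>i<p. centered (int p) a x y)"
    unfolding sum_subtractf sum.distrib
    by (simp add: sum_label_orbit[OF assms(1)] assms centered_T[OF assms])
  also have "\<dots> = int p * centered (int p) a x y" by simp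
  finally show ?thesis using p_ge_3 by simp
qed

text \<open>Modulo \<open>p\<close>, pairing the next chain with \<open>b \<smile> \<psi>\<close>, where
  \<open>b = \<delta>u\<close> is the carry cocycle of a labelling \<open>a\<close>, amounts to pairing the given chain with
  \<open>\<psi>\<close>: summing \<open>u\<close> over the orbit gives an invariant lift of \<open>\<delta>a\<close>, and \<open>a\<close> grows by \<open>1\<close> under
  \<open>T\<close>.\<close>

lemma exists_chain:
  assumes "\<epsilon> > 0"
  shows "\<exists>I. chain (X (2 * n)) \<epsilon> (2 * n + 1) I \<and>
    (\<forall>\<phi>. I (coboundary (\<lambda>\<sigma>. \<phi> (map T \<sigma>))) = I (coboundary \<phi>)) \<and>
    (\<forall>as. length as = n \<longrightarrow> (\<forall>a\<in>set as. labelling (2 * n) a) \<longrightarrow>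
       int p dvd I (cup (int p) as) - 1)"
  using assms
proof (induction n arbitrary: \<epsilon>)
  case 0
  obtain x where "x \<in> X 0" using X_nonempty by blast
  then have "chain (X 0) \<epsilon> 1 (\<lambda>\<phi>. \<phi> [x])"
    using \<open>\<epsilon> > 0\<close> by (auto simp: chain_def small_tuple_def)
  then show ?case by (intro exI[of _ "\<lambda>\<phi>. \<phi> [x]"]) auto
next
  case (Suc n)
  let ?X = "X (2 * n)" and ?Y = "X (Suc (2 * n))" and ?Z = "X (Suc (Suc (2 * n)))"
  \<comment> \<open>The bounds on the tuples are chosen backwards: \<open>\<delta>2\<close> for the
    second cone, \<open>\<delta>3\<close> for the orbit sum that it fills, \<open>\<delta>1\<close>
    for the first cone, \<open>\<delta>0\<close> for the image under \<open>T\<close> of the given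
    chain.\<close>
  obtain \<delta>2 where \<delta>2: "\<delta>2 > 0"
    "\<And>I m. chain ?Y \<delta>2 m I \<Longrightarrow> (\<And>\<phi>. I (coboundary \<phi>) = 0) \<Longrightarrow>
       \<exists>J. chain ?Z \<epsilon> (Suc m) J \<and> (\<forall>\<phi>. J (coboundary \<phi>) = I \<phi>)"
    using chain_cone[OF compact_X X_Suc Suc.prems continuous_H H_image H_0 H_1 v_in] by metis
  obtain \<delta>3 where \<delta>3: "\<delta>3 > 0"
    "\<And>i x y. \<lbrakk>i < p; x \<in> ?Y; y \<in> ?Y; dist x y < \<delta>3\<rbrakk> \<Longrightarrow> dist ((T ^^ i) x) ((T ^^ i) y) < \<delta>2"
    using T_funpow_small[OF \<delta>2(1)] by metis
  obtain \<delta>1 where \<delta>1: "\<delta>1 > 0"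
    "\<And>I m. chain ?X \<delta>1 m I \<Longrightarrow> (\<And>\<phi>. I (coboundary \<phi>) = 0) \<Longrightarrow>
       \<exists>J. chain ?Y \<delta>3 (Suc m) J \<and> (\<forall>\<phi>. J (coboundary \<phi>) = I \<phi>)"
    using chain_cone[OF compact_X X_Suc \<delta>3(1) continuous_H H_image H_0 H_1 v_in] by metis
  obtain \<delta>0 where \<delta>0: "\<delta>0 > 0"
    "\<And>i x y. \<lbrakk>i < 2; x \<in> ?X; y \<in> ?X; dist x y < \<delta>0\<rbrakk> \<Longrightarrow> dist ((T ^^ i) x) ((T ^^ i) y) < \<delta>1"
    using T_funpow_small[OF \<delta>1(1), of 2] by metis
  obtain I where I: "chain ?X (min \<delta>0 \<delta>1) (2 * n + 1) I"
    and I_T: "\<And>\<phi>. I (coboundary (\<lambda>\<sigma>. \<phi> (map T \<sigma>))) = I (coboundary \<phi>)"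
    and I_cup: "\<And>as. \<lbrakk>length as = n; \<forall>a\<in>set as. labelling (2 * n) a\<rbrakk> \<Longrightarrow>
       int p dvd I (cup (int p) as) - 1"
    using Suc.IH[of "min \<delta>0 \<delta>1"] \<delta>0(1) \<delta>1(1) by auto
  \<comment> \<open>The boundary of \<open>I\<close> is invariant, so the image of \<open>I\<close>
    under \<open>T\<close> minus \<open>I\<close> is a cycle. \<open>J\<close> fills it one level
    up, without symmetry.\<close>
  have "chain ?X \<delta>1 (2 * n + 1) (\<lambda>\<phi>. I (\<lambda>\<sigma>. \<phi> (map T \<sigma>)) - I \<phi>)"
    by (intro chain_diff_chain chain_pullback[OF I] chain_mono[OF I])
      (use \<delta>0(2)[of 1] T_X in auto)
  from \<delta>1(2)[OF this] obtain J where J: "chain ?Y \<delta>3 (2 * n + 2) J"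
    and J_cob: "\<And>\<phi>. J (coboundary \<phi>) = I (\<lambda>\<sigma>. \<phi> (map T \<sigma>)) - I \<phi>"
    using I_T unfolding coboundary_map_fun by auto
  \<comment> \<open>The orbit sum of \<open>J\<close> is a cycle: its boundary telescopes to the
    image of \<open>I\<close> under \<open>T ^^ p\<close> minus \<open>I\<close>. \<open>K\<close>
    fills it, and the boundary of \<open>K\<close>, being an orbit sum, is invariant.\<close>
  have J_orbit: "chain ?Y \<delta>2 (2 * n + 2) (\<lambda>\<phi>. \<Sum>i<p. J (\<lambda>\<sigma>. \<phi> (map (T ^^ i) \<sigma>)))"
    by (intro chain_sum_chain chain_pullback[OF J]) (use \<delta>3(2) T_funpow_X in auto)
  have J_T_pow: "J (\<lambda>\<sigma>. \<phi> (map (T ^^ p) \<sigma>)) = J \<phi>" for \<phi>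
  proof (rule chain_cong[OF J])
    fix \<sigma> assume "small_tuple ?Y \<delta>3 (2 * n + 2) \<sigma>"
    then have "map (T ^^ p) \<sigma> = \<sigma>"
      using T_pow by (intro map_idI) (auto simp: small_tuple_def)
    then show "\<phi> (map (T ^^ p) \<sigma>) = \<phi> \<sigma>" by simp
  qed
  have I_T_pow: "I (\<lambda>\<sigma>. \<phi> (map (T ^^ p) \<sigma>)) = I \<phi>" for \<phi>
  proof (rule chain_cong[OF I])
    fix \<sigma> assume "small_tuple ?X (min \<delta>0 \<delta>1) (2 * n + 1) \<sigma>"
    then have "map (T ^^ p) \<sigma> = \<sigma>"
      using T_pow by (intro map_idI) (auto simp: small_tuple_def)
    then show "\<phi> (map (T ^^ p) \<sigma>) = \<phi> \<sigma>" by simp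
  qed
  have cycle: "(\<Sum>i<p. J (\<lambda>\<sigma>. coboundary \<phi> (map (T ^^ i) \<sigma>))) = 0" for \<phi>
  proof -
    have "J (\<lambda>\<sigma>. coboundary \<phi> (map (T ^^ i) \<sigma>)) =
        I (\<lambda>\<sigma>. \<phi> (map (T ^^ Suc i) \<sigma>)) - I (\<lambda>\<sigma>. \<phi> (map (T ^^ i) \<sigma>))" for i
      using J_cob[of "\<lambda>\<sigma>. \<phi> (map (T ^^ i) \<sigma>)"]
      by (simp add: coboundary_map[of \<phi>, symmetric] funpow_Suc_right del: funpow.simps)
    then have "(\<Sum>i<p. J (\<lambda>\<sigma>. coboundary \<phi> (map (T ^^ i) \<sigma>))) =
        I (\<lambda>\<sigma>. \<phi> (map (T ^^ p) \<sigma>)) - I (\<lambda>\<sigma>. \<phi> (map (T ^^ 0) \<sigma>))"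
      by (simp only: sum_lessThan_telescope[of "\<lambda>i. I (\<lambda>\<sigma>. \<phi> (map (T ^^ i) \<sigma>))"])
    then show ?thesis using I_T_pow by simp
  qed
  obtain K where K: "chain ?Z \<epsilon> (2 * n + 3) K"
    and K_cob: "\<And>\<phi>. K (coboundary \<phi>) = (\<Sum>i<p. J (\<lambda>\<sigma>. \<phi> (map (T ^^ i) \<sigma>)))"
    using \<delta>2(2)[OF J_orbit cycle] by (auto simp: eval_nat_numeral)
  have K_T: "K (coboundary (\<lambda>\<sigma>. \<phi> (map T \<sigma>))) = K (coboundary \<phi>)" for \<phi>
  proof -
    have "K (coboundary (\<lambda>\<sigma>. \<phi> (map T \<sigma>))) = (\<Sum>i<p. J (\<lambda>\<sigma>. \<phi> (map (T ^^ Suc i) \<sigma>)))"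
      by (simp add: K_cob comp_def)
    also have "\<dots> = (\<Sum>i<p. J (\<lambda>\<sigma>. \<phi> (map (T ^^ i) \<sigma>)))
        + (J (\<lambda>\<sigma>. \<phi> (map (T ^^ p) \<sigma>)) - J (\<lambda>\<sigma>. \<phi> (map (T ^^ 0) \<sigma>)))"
      unfolding sum_lessThan_telescope[of "\<lambda>i. J (\<lambda>\<sigma>. \<phi> (map (T ^^ i) \<sigma>))", symmetric]
      by (simp add: sum_subtractf del: funpow.simps)
    also have "\<dots> = K (coboundary \<phi>)" using J_T_pow by (simp add: K_cob)
    finally show ?thesis .
  qed
  have "int p dvd K (cup (int p) (a # as)) - 1"
    if as: "length as = n" "\<forall>b\<in>set (a # as). labelling (Suc (Suc (2 * n))) b" for a as
  proof -
    have lab_Y: "labelling (Suc (2 * n)) a" "\<forall>b\<in>set as. labelling (Suc (2 * n)) b"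
      and lab_X: "labelling (2 * n) a" "\<forall>b\<in>set as. labelling (2 * n) b"
      using as(2) by (auto dest!: labelling_Suc)
    let ?\<psi> = "cup (int p) as"
    let ?u\<psi> = "\<lambda>\<sigma>. wrap (int p) a (hd \<sigma>) (hd (tl \<sigma>)) * ?\<psi> (tl \<sigma>)"
    let ?e\<psi> = "\<lambda>\<sigma>. centered (int p) a (hd \<sigma>) (hd (tl \<sigma>)) * ?\<psi> (tl \<sigma>)"
    let ?a\<psi> = "\<lambda>\<sigma>. a (hd \<sigma>) * ?\<psi> \<sigma>"
    have cocycle: "coboundary ?\<psi> \<sigma> = 0" if "length \<sigma> = 2 * n + 2" for \<sigma>
      by (rule coboundary_cup) (simp add: that as)
    have "K (cup (int p) (a # as)) = K (coboundary ?u\<psi>)"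
      by (rule chain_cong[OF K], rule cup_Cons_eq_coboundary[where m = "2 * n"])
        (use cocycle in \<open>auto simp: small_tuple_def\<close>)
    also have "\<dots> = J (\<lambda>\<sigma>. \<Sum>i<p. ?u\<psi> (map (T ^^ i) \<sigma>))"
      unfolding K_cob by (rule chain_sum[OF J, symmetric]) simp
    \<comment> \<open>\<open>?\<psi>\<close> is invariant and factors out of the orbit sum, which
      turns \<open>wrap\<close> into \<open>centered\<close>.\<close>
    also have "\<dots> = J ?e\<psi>"
    proof (rule chain_cong[OF J])
      fix \<sigma> assume "small_tuple ?Y \<delta>3 (2 * n + 2) \<sigma>"
      then obtain x y \<tau> where \<sigma>: "\<sigma> = x # y # \<tau>" "x \<in> ?Y" "y \<in> ?Y" "set \<tau> \<subseteq> ?Y"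
        using length_eq_SucSuc[of \<sigma> "2 * n"] by (auto simp: small_tuple_def)
      have "(\<Sum>i<p. ?u\<psi> (map (T ^^ i) \<sigma>)) =
          (\<Sum>i<p. wrap (int p) a ((T ^^ i) x) ((T ^^ i) y) * ?\<psi> (y # \<tau>))"
        by (rule sum.cong[OF refl])
          (use \<sigma> cup_T[OF lab_Y(2), of "y # \<tau>"] in auto)
      also have "\<dots> = ?e\<psi> \<sigma>"
        using sum_wrap_orbit[OF lab_Y(1) \<sigma>(2,3)] \<sigma>(1) by (simp flip: sum_distrib_right)
      finally show "(\<Sum>i<p. ?u\<psi> (map (T ^^ i) \<sigma>)) = ?e\<psi> \<sigma>" .
    qed
    \<comment> \<open>\<open>centered\<close> is the coboundary of \<open>a\<close> plus
      \<open>p\<close> times \<open>wrap\<close>, and \<open>?\<psi>\<close> is a cocycle. So modulo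
      \<open>p\<close> only a coboundary is left, which \<open>J_cob\<close> moves to
      \<open>I\<close>.\<close>
    also have "\<dots> = J (\<lambda>\<sigma>. coboundary ?a\<psi> \<sigma> + int p * ?u\<psi> \<sigma>)"
    proof (rule chain_cong[OF J])
      fix \<sigma> assume "small_tuple ?Y \<delta>3 (2 * n + 2) \<sigma>"
      then obtain x y \<tau> where \<sigma>: "\<sigma> = x # y # \<tau>" "length \<tau> = 2 * n"
        using length_eq_SucSuc[of \<sigma> "2 * n"] by (auto simp: small_tuple_def)
      have "coboundary ?\<psi> (x # y # \<tau>) = 0" by (rule cocycle) (simp add: \<sigma>)
      from coboundary_cup_label[OF this, of a]
      show "?e\<psi> \<sigma> = coboundary ?a\<psi> \<sigma> + int p * ?u\<psi> \<sigma>"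
        by (simp add: \<sigma> centered_eq_wrap algebra_simps del: coboundary.simps)
    qed
    also have "\<dots> = I (\<lambda>\<sigma>. ?a\<psi> (map T \<sigma>)) - I ?a\<psi> + int p * J ?u\<psi>"
      by (simp only: chain_add[OF J] chain_cmult[OF J] J_cob)
    \<comment> \<open>Under \<open>T\<close> the label grows by 1 up to a multiple of
      \<open>p\<close>, while \<open>?\<psi>\<close> is unchanged. The difference leaves
      \<open>I ?\<psi>\<close>, which is 1 modulo \<open>p\<close> by induction.\<close>
    also have "I (\<lambda>\<sigma>. ?a\<psi> (map T \<sigma>)) =
        I (\<lambda>\<sigma>. (?a\<psi> \<sigma> + ?\<psi> \<sigma>) + int p * (- ((a (hd \<sigma>) + 1) div int p) * ?\<psi> \<sigma>))"
    proof (rule chain_cong[OF I])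
      fix \<sigma> assume "small_tuple ?X (min \<delta>0 \<delta>1) (2 * n + 1) \<sigma>"
      then obtain x \<tau> where \<sigma>: "\<sigma> = x # \<tau>" "set \<sigma> \<subseteq> ?X"
        by (cases \<sigma>) (auto simp: small_tuple_def)
      have "a (T x) = a x + 1 + int p * - ((a x + 1) div int p)"
        using lab_X(1) \<sigma> by (simp add: labelling_def minus_mult_div_eq_mod)
      moreover have "?\<psi> (T x # map T \<tau>) = ?\<psi> \<sigma>"
        using cup_T[OF lab_X(2) \<sigma>(2), of 1] \<sigma>(1) by simp
      ultimately show "?a\<psi> (map T \<sigma>) =
          (?a\<psi> \<sigma> + ?\<psi> \<sigma>) + int p * (- ((a (hd \<sigma>) + 1) div int p) * ?\<psi> \<sigma>)"
        using \<sigma>(1) by (simp only: list.map list.sel ring_distribs mult.assoc mult_1_left)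
    qed
    also have "\<dots> = I ?a\<psi> + I ?\<psi> + int p * I (\<lambda>\<sigma>. - ((a (hd \<sigma>) + 1) div int p) * ?\<psi> \<sigma>)"
      by (simp only: chain_add[OF I] chain_cmult[OF I])
    finally have "K (cup (int p) (a # as)) - 1 = (I ?\<psi> - 1)
        + int p * (I (\<lambda>\<sigma>. - ((a (hd \<sigma>) + 1) div int p) * ?\<psi> \<sigma>) + J ?u\<psi>)"
      by (simp add: algebra_simps)
    then show ?thesis
      using I_cup[OF as(1) lab_X(2)] by (simp only: dvd_add dvd_triv_left)
  qed
  then have "\<forall>as. length as = Suc n \<longrightarrow> (\<forall>a\<in>set as. labelling (2 * Suc n) a) \<longrightarrow>
       int p dvd K (cup (int p) as) - 1"
    by (auto simp: length_Suc_conv)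
  then show ?case using K K_T by (auto intro!: exI[of _ K] simp: eval_nat_numeral)
qed

end

section \<open>Common zeros of equivariant maps\<close>

text \<open>With integer lifts in \<open>{g, g + 1}\<close> all differences have absolute value at
  most 1. As \<open>p \<ge> 3\<close>, they agree with their centered representatives, and the
  coboundary of true differences is 0.\<close>

lemma carry_eq_zero:
  fixes p :: int
  assumes "p \<ge> 3" "\<And>w. w \<in> {x, y, z} \<Longrightarrow> \<exists>A\<in>{g, g + 1}. a w = A mod p"
  shows "carry p a x y z = 0"
proof -
  obtain A where A: "\<And>w. w \<in> {x, y, z} \<Longrightarrow> A w \<in> {g, g + 1} \<and> a w = A w mod p"
    using assms(2) by metis
  have "centered p a u w = A w - A u" if "u \<in> {x, y, z}" "w \<in> {x, y, z}" for u w
  proof -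
    have "centered p a u w = centered p A u w"
      by (rule centered_cong) (simp add: A[OF that(1)] A[OF that(2)] mod_diff_eq)
    also have "\<dots> = A w - A u"
      using A[OF that(1)] A[OF that(2)] assms(1) unfolding centered_def by auto
    finally show ?thesis .
  qed
  then have "p * carry p a x y z = 0"
    unfolding carry_eq_centered by simp
  then show ?thesis using assms(1) by simp
qed

definition sector :: "nat \<Rightarrow> complex \<Rightarrow> int" where
  "sector p z = \<lfloor>real p * Arg z / (2 * pi)\<rfloor> mod int p"

text \<open>Any argument may replace \<open>Arg\<close>: a full turn adds \<open>p\<close> to the
  floor.\<close>

lemma sector_rcis:
  assumes "r > 0" "p > 0"
  shows "sector p (rcis r \<theta>) = \<lfloor>real p * \<theta> / (2 * pi)\<rfloor> mod int p"
proof -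
  have "cis \<theta> = cis (Arg (rcis r \<theta>))"
    using assms(1) rcis_cmod_Arg[of "rcis r \<theta>"] by (simp add: rcis_def norm_mult)
  then have "sin \<theta> = sin (Arg (rcis r \<theta>)) \<and> cos \<theta> = cos (Arg (rcis r \<theta>))"
    by (simp add: complex_eq_iff)
  then obtain k :: int where k: "\<theta> = Arg (rcis r \<theta>) + 2 * pi * of_int k"
    using sin_cos_eq_iff by blast
  have "real p * \<theta> / (2 * pi) = real p * Arg (rcis r \<theta>) / (2 * pi) + of_int (int p * k)"
    by (subst k) (simp add: field_simps)
  then have "\<lfloor>real p * \<theta> / (2 * pi)\<rfloor> = \<lfloor>real p * Arg (rcis r \<theta>) / (2 * pi)\<rfloor> + int p * k"
    by (metis floor_add_int)
  then show ?thesis by (simp add: sector_def)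
qed

lemma sector_rotate:
  assumes "z \<noteq> 0" "p > 0"
  shows "sector p (cis (2 * pi / real p) * z) = (sector p z + 1) mod int p"
proof -
  have "cis (2 * pi / real p) * z = rcis (cmod z) (Arg z + 2 * pi / real p)"
    by (metis add.commute cis_mult mult.left_commute rcis_cmod_Arg rcis_def)
  then have "sector p (cis (2 * pi / real p) * z) =
      \<lfloor>real p * (Arg z + 2 * pi / real p) / (2 * pi)\<rfloor> mod int p"
    using sector_rcis assms by simp
  also have "real p * (Arg z + 2 * pi / real p) / (2 * pi) = real p * Arg z / (2 * pi) + 1"
    using assms by (simp add: field_simps)
  finally show ?thesis by (simp add: sector_def mod_add_left_eq)
qed

text \<open>A turn by less than half a sector leaves two candidates for the sector of
  \<open>w\<close>. They depend on \<open>z\<close> only, so they serve all points near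
  \<open>z\<close> at once.\<close>

lemma sector_near:
  assumes "z \<noteq> 0" "w \<noteq> 0" "p > 0" "\<bar>Arg (w / z)\<bar> < pi / real p"
  shows "\<exists>A\<in>{\<lfloor>real p * Arg z / (2 * pi) - 1/2\<rfloor>, \<lfloor>real p * Arg z / (2 * pi) - 1/2\<rfloor> + 1}.
    sector p w = A mod int p"
proof -
  have "w = z * (w / z)" using assms by simp
  also have "\<dots> = rcis (cmod z * cmod (w / z)) (Arg z + Arg (w / z))"
    by (metis rcis_cmod_Arg rcis_mult)
  finally have "sector p w = \<lfloor>real p * (Arg z + Arg (w / z)) / (2 * pi)\<rfloor> mod int p"
    using sector_rcis[of "cmod z * cmod (w / z)" p "Arg z + Arg (w / z)"] assms by auto
  moreover have "real p * (Arg z + Arg (w / z)) / (2 * pi) =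
      real p * Arg z / (2 * pi) + real p * Arg (w / z) / (2 * pi)"
    by (simp add: field_simps)
  moreover have "\<bar>real p * Arg (w / z) / (2 * pi)\<bar> < 1 / 2"
    using assms(3,4) by (simp add: field_simps abs_mult)
  ultimately show ?thesis
    by (intro bexI[of _ "\<lfloor>real p * (Arg z + Arg (w / z)) / (2 * pi)\<rfloor>"])
      (assumption, simp only: insert_iff empty_iff, linarith)
qed

lemma Arg_small:
  assumes "\<eta> > 0"
  obtains s where "s > 0" "\<And>w. cmod (w - 1) < s \<Longrightarrow> \<bar>Arg w\<bar> < \<eta>"
proof -
  have "isCont Arg 1" by (rule continuous_at_Arg) auto
  then obtain s where "s > 0" "\<And>w. dist w 1 < s \<Longrightarrow> dist (Arg w) (Arg 1) < \<eta>"
    unfolding continuous_at_eps_delta using assms by blast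
  then show ?thesis using that[of s] by (simp add: dist_norm)
qed

context contractible_tower
begin

theorem equivariant_common_zero:
  fixes \<Phi> :: "nat \<Rightarrow> 'a \<Rightarrow> complex"
  assumes cont: "\<And>j. j < n \<Longrightarrow> continuous_on (X (2 * n)) (\<Phi> j)"
    and equiv: "\<And>j x. \<lbrakk>j < n; x \<in> X (2 * n)\<rbrakk> \<Longrightarrow> \<Phi> j (T x) = cis (2 * pi / real p) * \<Phi> j x"
  shows "\<exists>x\<in>X (2 * n). \<forall>j<n. \<Phi> j x = 0"
proof (rule ccontr)
  let ?X = "X (2 * n)"
  assume "\<not> ?thesis"
  then have nz: "\<exists>j<n. \<Phi> j x \<noteq> 0" if "x \<in> ?X" for x using that by blast
  have X_mono: "X 0 \<subseteq> X k" for k by (induction k) (use X_Suc in blast)+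
  then have ne: "?X \<noteq> {}" using X_nonempty by blast
  then have "n > 0" using nz by force
  have "continuous_on ?X (\<lambda>x. \<Sum>j<n. cmod (\<Phi> j x))"
    by (intro continuous_intros cont) auto
  from continuous_attains_inf[OF compact_X ne this] obtain x0
    where x0: "x0 \<in> ?X" "\<And>x. x \<in> ?X \<Longrightarrow> (\<Sum>j<n. cmod (\<Phi> j x0)) \<le> (\<Sum>j<n. cmod (\<Phi> j x))"
    by blast
  \<comment> \<open>The minimum over \<open>?X\<close> of the sum of the moduli, divided by
    \<open>n\<close>: at every point some coordinate has at least this modulus.\<close>
  define m where "m = (\<Sum>j<n. cmod (\<Phi> j x0)) / n"
  have "(\<Sum>j<n. cmod (\<Phi> j x0)) > 0"
    using nz[OF x0(1)] by (metis lessThan_iff finite_lessThan norm_ge_zero sum_pos2 zero_less_norm_iff)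
  then have "m > 0" using \<open>n > 0\<close> by (simp add: m_def)
  have large: "\<exists>j<n. cmod (\<Phi> j x) \<ge> m" if "x \<in> ?X" for x
  proof (rule ccontr)
    assume "\<not> ?thesis"
    then have "(\<Sum>j<n. cmod (\<Phi> j x)) < (\<Sum>j<n. m)"
      using \<open>n > 0\<close> by (intro sum_strict_mono) auto
    then show False using x0(2)[OF that] \<open>n > 0\<close> by (simp add: m_def)
  qed
  have p: "p > 0" "int p \<ge> 3" using p_ge_3 by auto
  obtain s where s: "s > 0" "\<And>w. cmod (w - 1) < s \<Longrightarrow> \<bar>Arg w\<bar> < pi / real p"
    using Arg_small[of "pi / real p"] p by auto
  \<comment> \<open>The bound by \<open>s\<close> keeps the quotient of nearby values in the range
    of \<open>Arg_small\<close>; the bound by 1 keeps the nearby value nonzero.\<close>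
  define \<eta> where "\<eta> = m * min s 1"
  have \<eta>: "\<eta> > 0" using s \<open>m > 0\<close> by (simp add: \<eta>_def)
  have "\<exists>\<delta>>0. \<forall>x\<in>?X. \<forall>y\<in>?X. dist x y < \<delta> \<longrightarrow> cmod (\<Phi> j y - \<Phi> j x) < \<eta>" if "j < n" for j
    using compact_uniformly_continuous[OF cont[OF that] compact_X] \<eta>
    unfolding uniformly_continuous_on_def by (metis dist_commute dist_norm)
  then obtain d where d: "\<And>j. j < n \<Longrightarrow> d j > 0"
    "\<And>j x y. \<lbrakk>j < n; x \<in> ?X; y \<in> ?X; dist x y < d j\<rbrakk> \<Longrightarrow> cmod (\<Phi> j y - \<Phi> j x) < \<eta>"
    by metis
  define \<epsilon> where "\<epsilon> = Min (d ` {..<n})"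
  have \<epsilon>: "\<epsilon> > 0" "\<And>j. j < n \<Longrightarrow> \<epsilon> \<le> d j"
    using d(1) \<open>n > 0\<close> unfolding \<epsilon>_def by (subst Min_gr_iff) auto
  \<comment> \<open>Where coordinate \<open>j\<close> vanishes, the first nonvanishing coordinate
    supplies the label. The labelling is thus equivariant on the whole space, though it may jump
    there.\<close>
  define a where "a j x =
    sector p (\<Phi> (if \<Phi> j x \<noteq> 0 then j else (LEAST i. i < n \<and> \<Phi> i x \<noteq> 0)) x)" for j x
  have lab: "labelling (2 * n) (a j)" if "j < n" for j
    unfolding labelling_def
  proof (intro ballI conjI)
    fix x assume x: "x \<in> ?X"
    show "a j x \<in> {0..<int p}" using p by (simp add: a_def sector_def)
    let ?i = "if \<Phi> j x \<noteq> 0 then j else (LEAST i. i < n \<and> \<Phi> i x \<noteq> 0)"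
    have i: "?i < n \<and> \<Phi> ?i x \<noteq> 0"
      using that LeastI_ex[OF nz[OF x]] by auto
    have eqv: "i < n \<Longrightarrow> \<Phi> i (T x) \<noteq> 0 \<longleftrightarrow> \<Phi> i x \<noteq> 0" for i
      using equiv[OF _ x] by simp
    have "a j (T x) = sector p (\<Phi> ?i (T x))"
    proof -
      have "(\<lambda>i. i < n \<and> \<Phi> i (T x) \<noteq> 0) = (\<lambda>i. i < n \<and> \<Phi> i x \<noteq> 0)"
        using eqv by blast
      then show ?thesis unfolding a_def eqv[OF that] by (simp only:)
    qed
    also have "\<dots> = (sector p (\<Phi> ?i x) + 1) mod int p"
      using equiv[OF conjunct1[OF i] x] sector_rotate[OF conjunct2[OF i] p(1)] by simp
    finally show "a j (T x) = (a j x + 1) mod int p" by (simp add: a_def)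
  qed
  obtain I where I: "chain ?X \<epsilon> (2 * n + 1) I"
    and I_cup: "\<And>as. length as = n \<Longrightarrow> \<forall>a\<in>set as. labelling (2 * n) a \<Longrightarrow>
       int p dvd I (cup (int p) as) - 1"
    using exists_chain[OF \<epsilon>(1), of n] by blast
  let ?as = "map a [0..<n]"
  have "I (cup (int p) ?as) = I (\<lambda>_. 0)"
  proof (rule chain_cong[OF I])
    fix \<sigma> assume \<sigma>: "small_tuple ?X \<epsilon> (2 * n + 1) \<sigma>"
    then have len: "length \<sigma> = 2 * n + 1" and sub: "set \<sigma> \<subseteq> ?X" by (auto simp: small_tuple_def)
    \<comment> \<open>One point of the tuple selects a coordinate \<open>j\<close> that is large
      there; by smallness the labels of all points of the tuple then lie in two adjacent
      sectors.\<close>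
    define x where "x = hd \<sigma>"
    have x: "x \<in> set \<sigma>" using len by (cases \<sigma>) (auto simp: x_def)
    then obtain j where j: "j < n" "cmod (\<Phi> j x) \<ge> m" using large sub by blast
    have xnz: "\<Phi> j x \<noteq> 0" using j \<open>m > 0\<close> by auto
    have near: "\<exists>A\<in>{\<lfloor>real p * Arg (\<Phi> j x) / (2 * pi) - 1/2\<rfloor>,
        \<lfloor>real p * Arg (\<Phi> j x) / (2 * pi) - 1/2\<rfloor> + 1}. a j y = A mod int p" if "y \<in> set \<sigma>" for y
    proof -
      have "dist x y < d j" using \<sigma> x that \<epsilon>(2)[OF j(1)] by (fastforce simp: small_tuple_def)
      then have lt: "cmod (\<Phi> j y - \<Phi> j x) < \<eta>" using d(2) j(1) x that sub by blast
      also have "\<eta> \<le> m" using \<open>m > 0\<close> by (simp add: \<eta>_def min_def mult_left_le)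
      finally have ynz: "\<Phi> j y \<noteq> 0" using j(2) by auto
      have "cmod (\<Phi> j y / \<Phi> j x - 1) = cmod (\<Phi> j y - \<Phi> j x) / cmod (\<Phi> j x)"
        using xnz by (simp add: norm_divide[symmetric] diff_divide_distrib)
      also have "\<dots> < s"
      proof -
        have "\<eta> \<le> cmod (\<Phi> j x) * s"
          unfolding \<eta>_def using j(2) s(1) \<open>m > 0\<close> by (intro mult_mono) auto
        then show ?thesis using lt xnz by (simp add: divide_less_eq mult.commute)
      qed
      finally have "\<bar>Arg (\<Phi> j y / \<Phi> j x)\<bar> < pi / real p" by (rule s(2))
      from sector_near[OF xnz ynz p(1) this] show ?thesis using ynz by (simp add: a_def)
    qed
    have "carry (int p) (a j) u v w = 0" if "{u, v, w} \<subseteq> set \<sigma>" for u v w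
      by (rule carry_eq_zero[OF p(2)], rule near) (use that in auto)
    then show "cup (int p) ?as \<sigma> = 0"
      using j(1) len by (intro cup_eq_zero[where a = "a j"]) auto
  qed
  then have "I (cup (int p) ?as) = 0" using chain_zero[OF I] by simp
  moreover have "int p dvd I (cup (int p) ?as) - 1"
    by (rule I_cup) (use lab in auto)
  ultimately show False using p(2) by auto
qed

text \<open>Raising coordinate \<open>j\<close> to a power \<open>e j\<close> inverse to
  \<open>k j\<close> modulo \<open>p\<close> turns its character into the standard one without
  changing its zeros.\<close>

corollary character_common_zero:
  fixes \<Phi> :: "nat \<Rightarrow> 'a \<Rightarrow> complex" and k :: "nat \<Rightarrow> int"
  assumes cont: "\<And>j. j < n \<Longrightarrow> continuous_on (X (2 * n)) (\<Phi> j)"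
    and equiv: "\<And>j x. \<lbrakk>j < n; x \<in> X (2 * n)\<rbrakk> \<Longrightarrow>
      \<Phi> j (T x) = cis (2 * pi * real_of_int (k j) / real p) * \<Phi> j x"
    and "\<And>j. j < n \<Longrightarrow> coprime (k j) (int p)"
  shows "\<exists>x\<in>X (2 * n). \<forall>j<n. \<Phi> j x = 0"
proof -
  have p: "p > 0" using p_ge_3 by auto
  have "\<exists>e::nat. e > 0 \<and> int p dvd k j * int e - 1" if j: "j < n" for j
  proof -
    obtain u where u: "[k j * u = 1] (mod int p)"
      using cong_solve_coprime_int[OF assms(3)[OF j]] by blast
    \<comment> \<open>Adding \<open>p\<close> makes the exponent positive, so that the power
      vanishes only where the base does.\<close>
    define e where "e = nat (u mod int p) + p"
    have "int e = u mod int p + int p" using p by (simp add: e_def)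
    then have "[k j * int e = k j * u] (mod int p)"
      by (intro cong_mult) (auto simp: cong_def)
    then have "[k j * int e = 1] (mod int p)" using u cong_trans by blast
    then show ?thesis using p by (auto simp: e_def cong_iff_dvd_diff intro!: exI[of _ e])
  qed
  then obtain e :: "nat \<Rightarrow> nat" where e: "\<And>j. j < n \<Longrightarrow> e j > 0"
    "\<And>j. j < n \<Longrightarrow> int p dvd k j * int (e j) - 1"
    by metis
  have "\<exists>x\<in>X (2 * n). \<forall>j<n. \<Phi> j x ^ e j = 0"
  proof (rule equivariant_common_zero)
    fix j x assume j: "j < n" and x: "x \<in> X (2 * n)"
    obtain l where "k j * int (e j) - 1 = int p * l" using e(2)[OF j] by (rule dvdE)
    then have l: "real_of_int (k j) * real (e j) = 1 + real p * of_int l"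
      by (metis add.commute diff_add_cancel of_int_add of_int_mult of_int_of_nat_eq of_int_1)
    have "cis (2 * pi * real_of_int (k j) / real p) ^ e j =
        cis (2 * pi / real p + 2 * pi * of_int l)"
    proof -
      have "real (e j) * (2 * pi * real_of_int (k j) / real p) =
          2 * pi * (real_of_int (k j) * real (e j)) / real p" by simp
      also have "\<dots> = 2 * pi / real p + 2 * pi * of_int l"
        unfolding l using p by (simp add: field_simps)
      finally show ?thesis by (simp only: Complex.DeMoivre)
    qed
    also have "\<dots> = cis (2 * pi / real p)"
      by (simp add: cis_mult[symmetric] cis_multiple_2pi)
    finally show "\<Phi> j (T x) ^ e j = cis (2 * pi / real p) * \<Phi> j x ^ e j"
      using equiv[OF j x] by (simp add: power_mult_distrib)
  qed (intro continuous_intros cont)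
  then show ?thesis using e(1) by (metis power_not_zero)
qed

end

section \<open>The deleted join of a simplex\<close>

lemma continuous_on_coordinate:
  "continuous_on S (\<lambda>y::'a \<Rightarrow> 'b::topological_space. y i)"
  by (rule continuous_on_subset[OF continuous_on_product_coordinates]) simp

lemma compact_unit_cube: "compact {y::'a \<Rightarrow> real. \<forall>c. 0 \<le> y c \<and> y c \<le> 1}"
proof -
  have "compactin (product_topology (\<lambda>_::'a. euclideanreal) UNIV) (\<Pi>\<^sub>E c\<in>UNIV. {0..1})"
    by (subst compactin_PiE) (simp add: compactin_euclidean_iff)
  moreover have "(\<Pi>\<^sub>E c\<in>UNIV. {0..1}) = {y::'a \<Rightarrow> real. \<forall>c. 0 \<le> y c \<and> y c \<le> 1}"
    by auto
  ultimately show ?thesis by (simp add: euclidean_product_topology)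
qed

text \<open>The \<open>p\<close>-fold deleted join of the \<open>k\<close>-simplex with vertices \<open>{..k}\<close>: \<open>y (g, i)\<close> is the
  weight of the vertex \<open>i\<close> in the \<open>g\<close>-th join factor.\<close>

definition deleted_join :: "nat \<Rightarrow> nat \<Rightarrow> (nat \<times> nat \<Rightarrow> real) set" where
  "deleted_join p k = {y. (\<forall>c. 0 \<le> y c) \<and> (\<forall>g i. \<not> (g < p \<and> i \<le> k) \<longrightarrow> y (g, i) = 0) \<and>
     (\<forall>g h i. g \<noteq> h \<longrightarrow> y (g, i) * y (h, i) = 0) \<and> (\<Sum>g<p. \<Sum>i\<le>k. y (g, i)) = 1}"

text \<open>Factor \<open>g\<close> of the result is the cyclically preceding factor of
  \<open>y\<close>; adding \<open>p - 1\<close> avoids subtraction on natural numbers.\<close>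

definition rotate_factors :: "nat \<Rightarrow> (nat \<times> nat \<Rightarrow> real) \<Rightarrow> nat \<times> nat \<Rightarrow> real" where
  "rotate_factors p y = (\<lambda>(g, i). if g < p then y ((p - 1 + g) mod p, i) else 0)"

definition vertex_point :: "nat \<Rightarrow> nat \<times> nat \<Rightarrow> real" where
  "vertex_point k c = (if c = (0, k) then 1 else 0)"

definition cone_homotopy :: "nat \<Rightarrow> real \<times> (nat \<times> nat \<Rightarrow> real) \<Rightarrow> nat \<times> nat \<Rightarrow> real" where
  "cone_homotopy k = (\<lambda>(t, y) c. (1 - t) * y c + t * vertex_point (Suc k) c)"

lemma deleted_join_le_1:
  assumes "y \<in> deleted_join p k"
  shows "y c \<le> 1"
proof (cases c)
  case (Pair g i)
  have nonneg: "\<And>c. 0 \<le> y c" and out: "\<And>g i. \<not> (g < p \<and> i \<le> k) \<Longrightarrow> y (g, i) = 0"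
    and sum1: "(\<Sum>g<p. \<Sum>i\<le>k. y (g, i)) = 1"
    using assms by (auto simp: deleted_join_def)
  show ?thesis
  proof (cases "g < p \<and> i \<le> k")
    case True
    have "y (g, i) \<le> (\<Sum>i\<le>k. y (g, i))"
      using True nonneg by (intro member_le_sum) auto
    also have "\<dots> \<le> (\<Sum>g<p. \<Sum>i\<le>k. y (g, i))"
      using True nonneg by (intro member_le_sum[of g _ "\<lambda>g. \<Sum>i\<le>k. y (g, i)"] sum_nonneg) auto
    finally show ?thesis using sum1 Pair by simp
  next
    case False
    then show ?thesis using out[of g i] Pair by simp
  qed
qed

text \<open>The conditions are closed, and they confine the weights to a cube, which is compact by
  Tychonoff.\<close>

lemma compact_deleted_join: "compact (deleted_join p k)"
proof -
  have "closed (deleted_join p k)"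
  proof -
    have c: "continuous_on UNIV (\<lambda>y::nat \<times> nat \<Rightarrow> real. y c)" for c
      by (rule continuous_on_coordinate)
    have "closed {y::nat \<times> nat \<Rightarrow> real. \<forall>c. 0 \<le> y c}"
      by (rule closed_Collect_all, rule closed_Collect_le[OF continuous_on_const c])
    moreover have "closed {y::nat \<times> nat \<Rightarrow> real. \<forall>g i. \<not> (g < p \<and> i \<le> k) \<longrightarrow> y (g, i) = 0}"
      by (rule closed_Collect_all, rule closed_Collect_all, rule closed_Collect_imp,
          rule open_Collect_const, rule closed_Collect_eq[OF c continuous_on_const])
    moreover have "closed {y::nat \<times> nat \<Rightarrow> real. \<forall>g h i. g \<noteq> h \<longrightarrow> y (g, i) * y (h, i) = 0}"
      by (rule closed_Collect_all, rule closed_Collect_all, rule closed_Collect_all,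
          rule closed_Collect_imp, rule open_Collect_const,
          rule closed_Collect_eq[OF continuous_on_mult[OF c c] continuous_on_const])
    moreover have "closed {y::nat \<times> nat \<Rightarrow> real. (\<Sum>g<p. \<Sum>i\<le>k. y (g, i)) = 1}"
      by (rule closed_Collect_eq[OF _ continuous_on_const])
        (rule continuous_on_sum, rule continuous_on_sum, rule c)
    ultimately show ?thesis
      unfolding deleted_join_def by (simp only: closed_Collect_conj)
  qed
  from compact_Int_closed[OF compact_unit_cube this]
  have "compact ({y. \<forall>c. 0 \<le> y c \<and> y c \<le> 1} \<inter> deleted_join p k)" .
  moreover have "{y. \<forall>c. 0 \<le> y c \<and> y c \<le> 1} \<inter> deleted_join p k = deleted_join p k"
    using deleted_join_le_1 by (auto simp: deleted_join_def)
  ultimately show ?thesis by (simp only:)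
qed

lemma vertex_point_in: "\<lbrakk>p > 0; j \<le> k\<rbrakk> \<Longrightarrow> vertex_point j \<in> deleted_join p k"
proof -
  assume p: "p > 0" and "j \<le> k"
  have "(\<Sum>i\<le>k. vertex_point j (g, i)) = (if g = 0 then 1 else 0)" for g
    using \<open>j \<le> k\<close> by (cases "g = 0") (simp_all add: vertex_point_def)
  then have "(\<Sum>g<p. \<Sum>i\<le>k. vertex_point j (g, i)) = 1"
    using p by simp
  then show ?thesis
    using p \<open>j \<le> k\<close> unfolding deleted_join_def by (simp add: vertex_point_def)
qed

lemma deleted_join_Suc: "deleted_join p k \<subseteq> deleted_join p (Suc k)"
  unfolding deleted_join_def by auto

text \<open>The new vertex \<open>Suc k\<close> has weight 0 in every factor of \<open>y\<close>, so
  giving it weight in factor 0 creates no overlap.\<close>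

lemma cone_homotopy_in:
  assumes "t \<in> {0..1}" "y \<in> deleted_join p k" "p > 0"
  shows "cone_homotopy k (t, y) \<in> deleted_join p (Suc k)"
proof -
  let ?v = "vertex_point (Suc k)"
  have y: "y \<in> deleted_join p (Suc k)" using assms deleted_join_Suc by blast
  have v: "?v \<in> deleted_join p (Suc k)" using assms by (intro vertex_point_in) auto
  have y0: "y (g, i) = 0" if "i > k" for g i
    using that assms(2) by (auto simp: deleted_join_def)
  have "(\<Sum>g<p. \<Sum>i\<le>Suc k. cone_homotopy k (t, y) (g, i)) =
      (1 - t) * (\<Sum>g<p. \<Sum>i\<le>Suc k. y (g, i)) + t * (\<Sum>g<p. \<Sum>i\<le>Suc k. ?v (g, i))"
    unfolding cone_homotopy_def prod.case sum_distrib_left sum.distrib ..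
  also have "\<dots> = 1" using y v unfolding deleted_join_def by auto
  finally have sum: "(\<Sum>g<p. \<Sum>i\<le>Suc k. cone_homotopy k (t, y) (g, i)) = 1" .
  have disj: "cone_homotopy k (t, y) (g, i) * cone_homotopy k (t, y) (h, i) = 0"
    if "g \<noteq> h" for g h i
  proof (cases "i > k")
    case True
    then show ?thesis using y0 that by (simp add: cone_homotopy_def vertex_point_def)
  next
    case False
    then have "?v (g, i) = 0" "?v (h, i) = 0" by (auto simp: vertex_point_def)
    moreover have "y (g, i) * y (h, i) = 0" using y that unfolding deleted_join_def by blast
    ultimately show ?thesis by (auto simp: cone_homotopy_def)
  qed
  show ?thesis
    unfolding deleted_join_def mem_Collect_eq
  proof (intro conjI allI impI)
    fix c
    have "0 \<le> y c" "0 \<le> ?v c" using y v unfolding deleted_join_def by blast+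
    then show "0 \<le> cone_homotopy k (t, y) c"
      using assms(1) by (simp add: cone_homotopy_def)
  next
    fix g i assume "\<not> (g < p \<and> i \<le> Suc k)"
    then have "y (g, i) = 0" "?v (g, i) = 0" using y v unfolding deleted_join_def by blast+
    then show "cone_homotopy k (t, y) (g, i) = 0" by (simp add: cone_homotopy_def)
  qed (use disj sum in auto)
qed

lemma rotate_factors_in:
  assumes "y \<in> deleted_join p k" "p > 0"
  shows "rotate_factors p y \<in> deleted_join p k"
proof -
  have "(\<Sum>g<p. \<Sum>i\<le>k. rotate_factors p y (g, i)) = (\<Sum>g<p. \<Sum>i\<le>k. y ((p - 1 + g) mod p, i))"
    by (simp add: rotate_factors_def)
  also have "\<dots> = (\<Sum>g<p. \<Sum>i\<le>k. y (g, i))"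
    using sum.reindex_bij_betw[OF bij_betw_add_mod[of "p - 1" p], of "\<lambda>g. \<Sum>i\<le>k. y (g, i)"] assms(2)
    by simp
  finally have sum: "(\<Sum>g<p. \<Sum>i\<le>k. rotate_factors p y (g, i)) = 1"
    using assms(1) by (simp add: deleted_join_def)
  have "p - 1 < p" using assms(2) by simp
  then have inj: "inj_on (\<lambda>i. (p - 1 + i) mod p) {..<p}"
    by (rule bij_betw_imp_inj_on[OF bij_betw_add_mod])
  have disj: "rotate_factors p y (g, i) * rotate_factors p y (h, i) = 0" if "g \<noteq> h" for g h i
  proof (cases "g < p \<and> h < p")
    case True
    then have "(p - 1 + g) mod p \<noteq> (p - 1 + h) mod p"
      using inj_onD[OF inj, of g h] that by blast
    then have "y ((p - 1 + g) mod p, i) * y ((p - 1 + h) mod p, i) = 0"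
      using assms(1) unfolding deleted_join_def by blast
    then show ?thesis using True by (simp add: rotate_factors_def)
  qed (auto simp: rotate_factors_def)
  show ?thesis
    unfolding deleted_join_def mem_Collect_eq
    using disj sum assms by (auto simp: rotate_factors_def deleted_join_def)
qed

lemma rotate_factors_pow:
  assumes "g < p"
  shows "(rotate_factors p ^^ n) y (g, i) = y ((n * (p - 1) + g) mod p, i)"
  using assms
proof (induction n arbitrary: g)
  case (Suc n)
  have "(rotate_factors p ^^ Suc n) y (g, i) = (rotate_factors p ^^ n) y ((p - 1 + g) mod p, i)"
    using Suc.prems by (simp add: rotate_factors_def[of p "(rotate_factors p ^^ n) y"])
  also have "\<dots> = y ((n * (p - 1) + (p - 1 + g) mod p) mod p, i)"
    using Suc.prems by (intro Suc.IH) simp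
  finally show ?case by (simp only: mod_add_right_eq mult_Suc add_ac)
qed simp

lemma rotate_factors_pow_id:
  assumes "y \<in> deleted_join p k" "p > 0"
  shows "(rotate_factors p ^^ p) y = y"
proof
  fix c :: "nat \<times> nat"
  obtain g i where c: "c = (g, i)" by force
  show "(rotate_factors p ^^ p) y c = y c"
  proof (cases "g < p")
    case True
    then show ?thesis using rotate_factors_pow[of g p p y i] c by simp
  next
    case False
    have "\<exists>z. (rotate_factors p ^^ p) y = rotate_factors p z"
      using assms(2) by (cases p) auto
    then show ?thesis using False assms(1) c
      by (auto simp: rotate_factors_def deleted_join_def)
  qed
qed

lemma contractible_tower_deleted_join:
  assumes "odd p" "p \<ge> 3"
  shows "contractible_tower (deleted_join p) (rotate_factors p) p cone_homotopy (\<lambda>k. vertex_point (Suc k))"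
proof
  have p: "p > 0" using assms by simp
  fix k
  show "continuous_on (deleted_join p k) (rotate_factors p)"
  proof (rule continuous_on_coordinatewise_then_product)
    fix c :: "nat \<times> nat"
    show "continuous_on (deleted_join p k) (\<lambda>y. rotate_factors p y c)"
      by (cases c; cases "fst c < p")
        (auto simp: rotate_factors_def intro: continuous_on_coordinate)
  qed
  show "continuous_on ({0..1} \<times> deleted_join p k) (cone_homotopy k)"
  proof (rule continuous_on_coordinatewise_then_product)
    fix c :: "nat \<times> nat"
    have "continuous_on ({0..1} \<times> deleted_join p k) (\<lambda>z. snd z c)"
      by (rule continuous_on_compose2[OF continuous_on_coordinate[of UNIV c]
            continuous_on_snd[OF continuous_on_id]]) simp
    then show "continuous_on ({0..1} \<times> deleted_join p k) (\<lambda>z. cone_homotopy k z c)"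
      unfolding cone_homotopy_def case_prod_unfold by (intro continuous_intros)
  qed
  show "cone_homotopy k ` ({0..1} \<times> deleted_join p k) \<subseteq> deleted_join p (Suc k)"
    using cone_homotopy_in p by auto
  show "deleted_join p 0 \<noteq> {}" using vertex_point_in[OF p, of 0 0] by auto
qed (use assms rotate_factors_in rotate_factors_pow_id deleted_join_Suc compact_deleted_join
    vertex_point_in in \<open>auto simp: cone_homotopy_def\<close>)

section \<open>Characters of Z/p and the discrete Fourier transform\<close>

definition unit_root :: "nat \<Rightarrow> int \<Rightarrow> complex" where
  "unit_root p m = cis (2 * pi * real_of_int m / real p)"

lemma unit_root_add: "unit_root p (m + n) = unit_root p m * unit_root p n"
  by (simp add: unit_root_def cis_mult ring_distribs add_divide_distrib)

lemma unit_root_0 [simp]: "unit_root p 0 = 1"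
  by (simp add: unit_root_def)

lemma unit_root_multiple:
  assumes "p > 0"
  shows "unit_root p (int p * k) = 1"
proof -
  have "2 * pi * real_of_int (int p * k) / real p = 2 * pi * of_int k"
    using assms by simp
  then show ?thesis by (simp add: unit_root_def cis_multiple_2pi)
qed

lemma unit_root_mod: "p > 0 \<Longrightarrow> unit_root p (m mod int p) = unit_root p m"
  using unit_root_add[of p "m mod int p" "int p * (m div int p)"]
  by (simp add: unit_root_multiple)

lemma unit_root_cong: "\<lbrakk>p > 0; m mod int p = n mod int p\<rbrakk> \<Longrightarrow> unit_root p m = unit_root p n"
  by (metis unit_root_mod)

lemma unit_root_power: "unit_root p (m * int n) = unit_root p m ^ n"
  by (simp add: unit_root_def Complex.DeMoivre mult.commute mult.left_commute)

lemma cnj_unit_root: "cnj (unit_root p m) = unit_root p (- m)"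
  by (simp add: unit_root_def cis_cnj)

lemma unit_root_eq_1_iff:
  assumes "p > 0"
  shows "unit_root p m = 1 \<longleftrightarrow> int p dvd m"
proof
  assume "unit_root p m = 1"
  then have "cos (2 * pi * real_of_int m / real p) = 1"
    by (simp add: unit_root_def complex_eq_iff)
  then obtain k :: int where "2 * pi * real_of_int m / real p = of_int k * 2 * pi"
    using cos_one_2pi_int by auto
  then have "real_of_int m = real_of_int (int p * k)"
    using assms by (simp add: field_simps)
  then show "int p dvd m" by (metis of_int_eq_iff dvd_triv_left)
next
  assume "int p dvd m"
  then show "unit_root p m = 1" using unit_root_multiple[OF assms] by (auto elim!: dvdE)
qed

lemma sum_unit_root:
  assumes "p > 0"
  shows "(\<Sum>g<p. unit_root p (m * int g)) = (if int p dvd m then of_nat p else 0)"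
proof (cases "int p dvd m")
  case True
  then show ?thesis
    using unit_root_eq_1_iff[OF assms, of m] by (simp add: unit_root_power)
next
  case False
  then have "(\<Sum>g<p. unit_root p m ^ g) = (unit_root p m ^ p - 1) / (unit_root p m - 1)"
    using unit_root_eq_1_iff[OF assms] by (intro geometric_sum) auto
  also have "unit_root p m ^ p = 1"
    using unit_root_multiple[OF assms, of m] unit_root_power[of p m p] by (simp add: mult.commute)
  finally show ?thesis using False by (simp add: unit_root_power)
qed

text \<open>Unnormalized, and with integer frequencies so that negative ones are available.\<close>

definition dft :: "nat \<Rightarrow> (nat \<Rightarrow> complex) \<Rightarrow> int \<Rightarrow> complex" where
  "dft p w h = (\<Sum>g<p. w g * unit_root p (- h * int g))"

lemma dft_mod: "p > 0 \<Longrightarrow> h mod int p = k mod int p \<Longrightarrow> dft p w h = dft p w k"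
  unfolding dft_def
  by (intro sum.cong refl arg_cong2[where f = "(*)"] unit_root_cong)
    (auto intro: mod_mult_cong mod_minus_cong)

text \<open>Orthogonality of characters: the inner sum over all frequencies singles out
  \<open>k = g\<close>.\<close>

lemma dft_inversion:
  assumes "g < p"
  shows "of_nat p * w g = (\<Sum>h<p. dft p w (int h) * unit_root p (int h * int g))"
proof -
  have p: "p > 0" using assms by simp
  have "(\<Sum>h<p. dft p w (int h) * unit_root p (int h * int g)) =
      (\<Sum>h<p. \<Sum>k<p. w k * unit_root p ((int g - int k) * int h))"
    unfolding dft_def sum_distrib_right
    by (intro sum.cong refl) (simp add: unit_root_add[symmetric] algebra_simps)
  also have "\<dots> = (\<Sum>k<p. w k * (\<Sum>h<p. unit_root p ((int g - int k) * int h)))"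
    by (subst sum.swap) (simp add: sum_distrib_left)
  also have "\<dots> = (\<Sum>k<p. w k * (if k = g then of_nat p else 0))"
  proof (intro sum.cong refl arg_cong2[where f = "(*)"])
    fix k assume "k \<in> {..<p}"
    then have "int p dvd int g - int k \<longleftrightarrow> k = g"
      using assms by (auto simp: mod_eq_dvd_iff[symmetric])
    then show "(\<Sum>h<p. unit_root p ((int g - int k) * int h)) = (if k = g then of_nat p else 0)"
      using sum_unit_root[OF p] by simp
  qed
  also have "\<dots> = of_nat p * w g" using assms by (simp add: if_distrib sum.delta' cong: if_cong)
  finally show ?thesis by simp
qed

text \<open>Reindexing the sum by one step trades the rotation for a character value; this is the
  source of equivariance of the test map.\<close>

lemma dft_rotate:
  assumes "p > 0"
  shows "dft p (\<lambda>g. w ((p - 1 + g) mod p)) h = unit_root p (- h) * dft p w h"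
proof -
  have "unit_root p (- h) * dft p w h = (\<Sum>g<p. unit_root p (- h) * (w ((p - 1 + g) mod p)
      * unit_root p (- h * int ((p - 1 + g) mod p))))"
    unfolding dft_def sum_distrib_left
    using sum.reindex_bij_betw[OF bij_betw_add_mod[of "p - 1" p],
        of "\<lambda>g. unit_root p (- h) * (w g * unit_root p (- h * int g))"] assms by simp
  also have "\<dots> = (\<Sum>g<p. w ((p - 1 + g) mod p) * unit_root p (- h * int g))"
  proof (intro sum.cong refl)
    fix g
    have "(1 + int ((p - 1 + g) mod p)) mod int p = int ((1 + (p - 1 + g)) mod p)"
      by (simp add: zmod_int mod_add_right_eq)
    also have "1 + (p - 1 + g) = p + g" using assms by simp
    finally have "(1 + int ((p - 1 + g) mod p)) mod int p = int g mod int p"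
      by (simp add: zmod_int)
    then have "(- h * (1 + int ((p - 1 + g) mod p))) mod int p = (- h * int g) mod int p"
      by (intro mod_mult_cong refl)
    then have "unit_root p (- h * (1 + int ((p - 1 + g) mod p))) = unit_root p (- h * int g)"
      by (rule unit_root_cong[OF assms])
    then show "unit_root p (- h) * (w ((p - 1 + g) mod p) * unit_root p (- h * int ((p - 1 + g) mod p)))
        = w ((p - 1 + g) mod p) * unit_root p (- h * int g)"
      using unit_root_add[of p "- h" "- h * int ((p - 1 + g) mod p)"]
      by (simp add: algebra_simps)
  qed
  also have "\<dots> = dft p (\<lambda>g. w ((p - 1 + g) mod p)) h" by (simp only: dft_def)
  finally show ?thesis by (rule sym)
qed

text \<open>The cone over \<open>standard_simplex k\<close> with apex 0. A factor of a point of the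
  deleted join is a point of the simplex scaled by its join parameter, which may be 0.\<close>

definition corner_simplex :: "nat \<Rightarrow> (nat \<Rightarrow> real) set" where
  "corner_simplex k = {z. (\<forall>i. 0 \<le> z i) \<and> (\<forall>i>k. z i = 0) \<and> (\<Sum>i\<le>k. z i) \<le> 1}"

lemma deleted_join_slice:
  assumes "y \<in> deleted_join p k"
  shows "(\<lambda>i. y (g, i)) \<in> corner_simplex k"
proof -
  have nonneg: "\<And>c. 0 \<le> y c" and out: "\<And>g i. \<not> (g < p \<and> i \<le> k) \<Longrightarrow> y (g, i) = 0"
    and sum1: "(\<Sum>g<p. \<Sum>i\<le>k. y (g, i)) = 1"
    using assms by (auto simp: deleted_join_def)
  have "(\<Sum>i\<le>k. y (g, i)) \<le> 1"
  proof (cases "g < p")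
    case True
    have "(\<Sum>i\<le>k. y (g, i)) \<le> (\<Sum>g<p. \<Sum>i\<le>k. y (g, i))"
      using True nonneg by (intro member_le_sum[of g _ "\<lambda>g. \<Sum>i\<le>k. y (g, i)"] sum_nonneg) auto
    then show ?thesis using sum1 by simp
  next
    case False
    then show ?thesis using out by simp
  qed
  then show ?thesis using nonneg out by (auto simp: corner_simplex_def)
qed

text \<open>By \<open>dft_rotate\<close> the condition at frequency \<open>h j\<close> transforms by
  the character of frequency \<open>- h j\<close>, and coprimality makes
  \<open>character_common_zero\<close> applicable.\<close>

theorem deleted_join_common_zero:
  fixes W :: "nat \<Rightarrow> (nat \<Rightarrow> real) \<Rightarrow> complex" and h :: "nat \<Rightarrow> nat"
  assumes "odd p" "p \<ge> 3"
    and cont: "\<And>j. j < n \<Longrightarrow> continuous_on (corner_simplex (2 * n)) (W j)"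
    and cop: "\<And>j. j < n \<Longrightarrow> coprime (h j) p"
  shows "\<exists>y\<in>deleted_join p (2 * n). \<forall>j<n. dft p (\<lambda>g. W j (\<lambda>i. y (g, i))) (int (h j)) = 0"
proof -
  interpret contractible_tower "deleted_join p" "rotate_factors p" p cone_homotopy
    "\<lambda>k. vertex_point (Suc k)"
    by (rule contractible_tower_deleted_join[OF assms(1,2)])
  show ?thesis
  proof (rule character_common_zero[where k = "\<lambda>j. - int (h j)"])
    fix j assume j: "j < n"
    show "coprime (- int (h j)) (int p)" using cop[OF j] by simp
    have "continuous_on (deleted_join p (2 * n)) (\<lambda>y. W j (\<lambda>i. y (g, i)))" for g
    proof (rule continuous_on_compose2[OF cont[OF j]])
      show "continuous_on (deleted_join p (2 * n)) (\<lambda>y i. y (g, i))"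
        by (intro continuous_on_coordinatewise_then_product continuous_on_coordinate)
    qed (use deleted_join_slice in auto)
    then show "continuous_on (deleted_join p (2 * n)) (\<lambda>y. dft p (\<lambda>g. W j (\<lambda>i. y (g, i))) (int (h j)))"
      unfolding dft_def by (intro continuous_intros)
    fix y
    have "dft p (\<lambda>g. W j (\<lambda>i. rotate_factors p y (g, i))) (int (h j)) =
        dft p (\<lambda>g. W j (\<lambda>i. y ((p - 1 + g) mod p, i))) (int (h j))"
      unfolding dft_def by (intro sum.cong) (auto simp: rotate_factors_def)
    also have "\<dots> = unit_root p (- int (h j)) * dft p (\<lambda>g. W j (\<lambda>i. y (g, i))) (int (h j))"
      using dft_rotate[of p "\<lambda>g. W j (\<lambda>i. y (g, i))"] p_ge_3 by simp
    finally show "dft p (\<lambda>g. W j (\<lambda>i. rotate_factors p y (g, i))) (int (h j)) =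
        cis (2 * pi * real_of_int (- int (h j)) / real p) * dft p (\<lambda>g. W j (\<lambda>i. y (g, i))) (int (h j))"
      by (simp add: unit_root_def)
  qed
qed

section \<open>The test map\<close>

lemma compact_standard_simplex: "compact (standard_simplex k)"
proof -
  have "closed (standard_simplex k)"
    using closedin_standard_simplex[of k] by (simp add: euclidean_product_topology)
  from compact_Int_closed[OF compact_unit_cube this]
  have "compact ({y. \<forall>c. 0 \<le> y c \<and> y c \<le> 1} \<inter> standard_simplex k)" .
  moreover have "{y. \<forall>c. 0 \<le> y c \<and> y c \<le> 1} \<inter> standard_simplex k = standard_simplex k"
    by (auto simp: standard_simplex_def)
  ultimately show ?thesis by (simp only:)
qed

lemma normalize_in_standard_simplex:
  assumes "z \<in> corner_simplex k" "(\<Sum>i\<le>k. z i) \<noteq> 0"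
  shows "(\<lambda>i. z i / (\<Sum>i\<le>k. z i)) \<in> standard_simplex k"
proof -
  have z: "\<And>i. 0 \<le> z i" "\<And>i. i > k \<Longrightarrow> z i = 0" using assms by (auto simp: corner_simplex_def)
  have pos: "(\<Sum>i\<le>k. z i) > 0" using assms(2) z(1) by (metis sum_nonneg order_le_less)
  have "z i \<le> (\<Sum>i\<le>k. z i)" for i
  proof (cases "i \<le> k")
    case True
    then show ?thesis using z(1) by (intro member_le_sum) auto
  next
    case False
    then show ?thesis using z pos by simp
  qed
  then show ?thesis
    using z pos unfolding standard_simplex_def
    by (auto simp: divide_le_eq simp flip: sum_divide_distrib)
qed

text \<open>Normalization breaks down at the apex, but \<open>f\<close> is bounded on the compact
  simplex and the scalar factor tends to 0 there. Elsewhere the formula is composed of continuous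
  maps.\<close>

lemma continuous_on_cone_extension:
  fixes f :: "(nat \<Rightarrow> real) \<Rightarrow> 'b::real_normed_vector"
  assumes "continuous_on (standard_simplex k) f"
  shows "continuous_on (corner_simplex k) (\<lambda>z. (\<Sum>i\<le>k. z i) *\<^sub>R f (\<lambda>i. z i / (\<Sum>i\<le>k. z i)))"
proof -
  define s where "s z = (\<Sum>i\<le>k. z i)" for z :: "nat \<Rightarrow> real"
  define F where "F z = s z *\<^sub>R f (\<lambda>i. z i / s z)" for z
  have s: "continuous_on A s" for A
    unfolding s_def by (intro continuous_on_sum continuous_on_coordinate)
  have norm_in: "(\<lambda>i. z i / s z) \<in> standard_simplex k" if "z \<in> corner_simplex k" "s z \<noteq> 0" for z
    using normalize_in_standard_simplex that unfolding s_def by blast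
  have "compact (f ` standard_simplex k)"
    by (rule compact_continuous_image[OF assms compact_standard_simplex])
  then have "bounded (f ` standard_simplex k)"
    by (rule compact_imp_bounded)
  then obtain B where "\<forall>y\<in>f ` standard_simplex k. norm y \<le> B"
    unfolding bounded_iff by (elim exE)
  then have B: "\<And>x. x \<in> standard_simplex k \<Longrightarrow> norm (f x) \<le> B" by simp
  have "(F \<longlongrightarrow> F z) (at z within corner_simplex k)" if z: "z \<in> corner_simplex k" for z
  proof (cases "s z = 0")
    case True
    have "norm (F w) \<le> B * \<bar>s w\<bar>" if "w \<in> corner_simplex k" for w
    proof (cases "s w = 0")
      case False
      then show ?thesis
        using mult_left_mono[OF B[OF norm_in[OF that False]], of "\<bar>s w\<bar>"]
        by (simp add: F_def mult.commute)
    qed (simp add: F_def)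
    then have "\<forall>\<^sub>F w in at z within corner_simplex k. norm (F w) \<le> B * \<bar>s w\<bar>"
      by (auto simp: eventually_at_filter)
    moreover have "((\<lambda>w. B * \<bar>s w\<bar>) \<longlongrightarrow> 0) (at z within corner_simplex k)"
    proof -
      have "(s \<longlongrightarrow> s z) (at z within corner_simplex k)"
        using s z unfolding continuous_on_def by blast
      then show ?thesis
        using True by (auto intro!: tendsto_eq_intros)
    qed
    ultimately have "(F \<longlongrightarrow> 0) (at z within corner_simplex k)"
      by (rule Lim_null_comparison)
    then show ?thesis using True by (simp add: F_def)
  next
    case False
    define U where "U = {w \<in> corner_simplex k. s w \<noteq> 0}"
    have "continuous_on U F"
      unfolding F_def
    proof (intro continuous_on_scaleR s)
      show "continuous_on U (\<lambda>z. f (\<lambda>i. z i / s z))"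
      proof (rule continuous_on_compose2[OF assms])
        show "continuous_on U (\<lambda>z i. z i / s z)"
          by (intro continuous_on_coordinatewise_then_product continuous_on_divide s
              continuous_on_coordinate) (auto simp: U_def)
      qed (use norm_in in \<open>auto simp: U_def\<close>)
    qed
    then have "(F \<longlongrightarrow> F z) (at z within U)"
      using z False unfolding continuous_on_def U_def by blast
    moreover have "at z within corner_simplex k = at z within U"
    proof (rule at_within_nhd)
      show "open {w. s w \<noteq> 0}"
        by (rule open_Collect_neq[OF s continuous_on_const])
    qed (use False in \<open>auto simp: U_def\<close>)
    ultimately show ?thesis by simp
  qed
  then have "continuous_on (corner_simplex k) F" by (simp add: continuous_on_def)
  then show ?thesis by (simp add: F_def[abs_def] s_def)
qed

definition elem_sym :: "nat \<Rightarrow> nat \<Rightarrow> (nat \<Rightarrow> real) \<Rightarrow> real" where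
  "elem_sym k r z = (\<Sum>A | A \<subseteq> {..k} \<and> card A = r. \<Prod>i\<in>A. z i)"

lemma continuous_on_elem_sym: "continuous_on S (elem_sym k r)"
  unfolding elem_sym_def by (intro continuous_on_sum continuous_on_prod continuous_on_coordinate)

text \<open>For nonnegative weights the sum vanishes only if each product does, that is, if no
  \<open>r\<close> vertices carry positive weight. A bound on the support thus becomes a continuous
  equation.\<close>

lemma elem_sym_eq_0_iff:
  assumes "\<And>i. 0 \<le> z i"
  shows "elem_sym k r z = 0 \<longleftrightarrow> card {i. i \<le> k \<and> z i \<noteq> 0} < r"
proof -
  let ?S = "{i. i \<le> k \<and> z i \<noteq> 0}"
  have fin: "finite {A. A \<subseteq> {..k} \<and> card A = r}" by (rule finite_subset[of _ "Pow {..k}"]) auto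
  have "elem_sym k r z = 0 \<longleftrightarrow> (\<forall>A. A \<subseteq> {..k} \<and> card A = r \<longrightarrow> (\<Prod>i\<in>A. z i) = 0)"
    unfolding elem_sym_def
    by (subst sum_nonneg_eq_0_iff[OF fin]) (auto intro: prod_nonneg assms)
  also have "\<dots> \<longleftrightarrow> \<not> (\<exists>A. A \<subseteq> ?S \<and> card A = r)"
  proof -
    have "(\<Prod>i\<in>A. z i) \<noteq> 0 \<longleftrightarrow> A \<subseteq> ?S" if "A \<subseteq> {..k}" for A
      using that finite_subset[OF that] by (auto simp: subset_eq)
    moreover have "A \<subseteq> ?S \<Longrightarrow> A \<subseteq> {..k}" for A by auto
    ultimately show ?thesis by blast
  qed
  also have "(\<exists>A. A \<subseteq> ?S \<and> card A = r) \<longleftrightarrow> r \<le> card ?S"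
  proof
    assume "\<exists>A. A \<subseteq> ?S \<and> card A = r"
    then obtain A where "A \<subseteq> ?S" "card A = r" by (elim exE conjE)
    then show "r \<le> card ?S" using card_mono[of ?S A] by simp
  next
    assume "r \<le> card ?S"
    then obtain A where "A \<subseteq> ?S" "card A = r" by (rule obtain_subset_with_card_n)
    then show "\<exists>A. A \<subseteq> ?S \<and> card A = r" by (intro exI conjI)
  qed
  finally show ?thesis by (simp add: not_le)
qed

text \<open>For real values the coefficient at \<open>p - h\<close> is conjugate to the one at
  \<open>h\<close>, so half of the nonzero frequencies control all of them; inversion then leaves
  frequency 0.\<close>

lemma dft_eq_0_imp_const:
  fixes w :: "nat \<Rightarrow> real"
  assumes "p > 0" and zero: "\<And>h. \<lbrakk>1 \<le> h; h \<le> p div 2\<rbrakk> \<Longrightarrow> dft p (\<lambda>g. of_real (w g)) (int h) = 0"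
    and "g < p"
  shows "w g = w 0"
proof -
  let ?w = "\<lambda>g. complex_of_real (w g)"
  have zero': "dft p ?w (int h) = 0" if "h \<in> {1..<p}" for h
  proof (cases "h \<le> p div 2")
    case True
    then show ?thesis using zero that by simp
  next
    case False
    then have h: "1 \<le> p - h" "p - h \<le> p div 2" using that by auto
    have "int h mod int p = (- int (p - h)) mod int p"
      using that by (simp add: of_nat_diff)
    then have "dft p ?w (int h) = dft p ?w (- int (p - h))"
      by (rule dft_mod[OF assms(1)])
    also have "\<dots> = cnj (dft p ?w (int (p - h)))"
      by (simp add: dft_def cnj_unit_root)
    finally show ?thesis using zero[OF h] by simp
  qed
  have "of_nat p * ?w i = dft p ?w 0" if "i < p" for i
  proof -
    have "of_nat p * ?w i = (\<Sum>h<p. dft p ?w (int h) * unit_root p (int h * int i))"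
      by (rule dft_inversion[OF that])
    also have "\<dots> = (\<Sum>h\<in>{0}. dft p ?w (int h) * unit_root p (int h * int i))"
      using assms(1) zero' by (intro sum.mono_neutral_right) auto
    finally show ?thesis by simp
  qed
  from trans[OF this[OF assms(3)] this[OF assms(1), symmetric]] show ?thesis
    using assms(1) by simp
qed

lemma sum_card_disjoint_le:
  assumes "\<And>g. g < r \<Longrightarrow> S g \<subseteq> {..k::nat}" "\<And>g h. \<lbrakk>g < r; h < r; g \<noteq> h\<rbrakk> \<Longrightarrow> S g \<inter> S h = {}"
  shows "(\<Sum>g<(r::nat). card (S g)) \<le> k + 1"
proof -
  have "(\<Sum>g<r. card (S g)) = card (\<Union>g<r. S g)"
    using assms finite_subset[OF assms(1)] by (intro card_UN_disjoint[symmetric]) simp_all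
  also have "\<dots> \<le> card {..k}"
    using assms(1) by (intro card_mono) auto
  finally show ?thesis by simp
qed

theorem disjoint_points_two_frequencies:
  fixes f :: "(nat \<Rightarrow> real) \<Rightarrow> real ^ 'd" and c :: "nat \<Rightarrow> 'd"
  assumes "Factorial_Ring.prime r" "odd r" "continuous_on (standard_simplex (r * (r - 1))) f"
  shows "\<exists>x C0 C1.
    (\<forall>g<r. x g \<in> standard_simplex (r * (r - 1))) \<and>
    (\<forall>g<r. card {i. x g i \<noteq> 0} < r) \<and>
    (\<forall>g<r. \<forall>h<r. \<forall>i. g \<noteq> h \<longrightarrow> x g i = 0 \<or> x h i = 0) \<and>
    (\<forall>g<r. \<forall>i<(r - 1) div 2.
       Complex (f (x g) $ c (2 * i)) (f (x g) $ c (2 * i + 1)) = C0 i + C1 i * unit_root r (int g))"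
proof -
  \<comment> \<open>There are \<open>(r - 1) div 2\<close> blocks of \<open>r\<close> complex
    conditions; twice their number is the dimension of the simplex.\<close>
  define n where "n = (r - 1) div 2 * r"
  define k where "k = r * (r - 1)"
  have k: "2 * n = k" using assms(2) by (simp add: n_def k_def)
  have "r \<ge> 2" using assms(1) by (rule prime_ge_2_nat)
  then have r: "r \<ge> 3" using assms(2) by (cases "r = 2") auto
  define s where "s z = (\<Sum>i\<le>k. z i)" for z :: "nat \<Rightarrow> real"
  define F where "F z = s z *\<^sub>R f (\<lambda>i. z i / s z)" for z
  \<comment> \<open>In block \<open>i\<close>, position 0 tests the join parameter and position 1
    the elementary symmetric function, both at frequency \<open>i + 1\<close>; position
    \<open>h \<ge> 2\<close> tests the \<open>i\<close>-th complex coordinate at frequency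
    \<open>h\<close>. The slots of the frequencies 0 and 1, which may survive, are thus
    reused.\<close>
  define V where "V i h z = (if h = 0 then of_real (s z)
    else if h = 1 then of_real (elem_sym k r z)
    else Complex (F z $ c (2 * i)) (F z $ c (2 * i + 1)))" for i h :: nat and z
  define W where "W j = V (j div r) (j mod r)" for j
  define freq where "freq j = (if j mod r \<le> 1 then j div r + 1 else j mod r)" for j
  have "\<exists>y\<in>deleted_join r (2 * n). \<forall>j<n. dft r (\<lambda>g. W j (\<lambda>i. y (g, i))) (int (freq j)) = 0"
  proof (rule deleted_join_common_zero[OF assms(2) r])
    fix j assume j: "j < n"
    have F: "continuous_on (corner_simplex k) F"
      using continuous_on_cone_extension[of k f] assms(3)
      by (simp add: F_def[abs_def] s_def k_def)
    have s: "continuous_on (corner_simplex k) s"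
      unfolding s_def by (intro continuous_on_sum continuous_on_coordinate)
    have "continuous_on (corner_simplex k) (\<lambda>z. Complex (F z $ i1) (F z $ i2))" for i1 i2
      unfolding Complex_eq by (intro continuous_intros F bounded_linear.continuous_on[OF bounded_linear_vec_nth])
    then show "continuous_on (corner_simplex (2 * n)) (W j)"
      unfolding k W_def V_def using s continuous_on_elem_sym[of "corner_simplex k" k r]
      by (cases "j mod r = 0"; cases "j mod r = 1") (simp_all add: continuous_on_of_real)
    have "j div r < (r - 1) div 2" using j r by (simp add: n_def less_mult_imp_div_less)
    then have "0 < freq j" "freq j < r" using r by (auto simp: freq_def)
    then have "\<not> r dvd freq j" by (simp add: nat_dvd_not_less)
    then show "coprime (freq j) r"
      using assms(1) by (simp add: prime_imp_coprime coprime_commute)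
  qed
  then obtain y where y: "y \<in> deleted_join r k"
    and zero: "\<And>j. j < n \<Longrightarrow> dft r (\<lambda>g. W j (\<lambda>i. y (g, i))) (int (freq j)) = 0"
    unfolding k by blast
  have y_nonneg: "\<And>c. 0 \<le> y c" and y_out: "\<And>g i. \<not> (g < r \<and> i \<le> k) \<Longrightarrow> y (g, i) = 0"
    and y_disj: "\<And>g h i. g \<noteq> h \<Longrightarrow> y (g, i) = 0 \<or> y (h, i) = 0"
    and y_sum: "(\<Sum>g<r. \<Sum>i\<le>k. y (g, i)) = 1"
    using y unfolding deleted_join_def by auto
  have zero': "dft r (\<lambda>g. V i h (\<lambda>i. y (g, i))) (int (if h \<le> 1 then i + 1 else h)) = 0"
    if "i < (r - 1) div 2" "h < r" for i h
  proof -
    have "i * r + h < (i + 1) * r" using that by simp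
    also have "\<dots> \<le> n" unfolding n_def using that by (intro mult_right_mono) auto
    finally have lt: "i * r + h < n" .
    have dm: "(i * r + h) div r = i" "(i * r + h) mod r = h" using that by simp_all
    show ?thesis
      using zero[OF lt] unfolding W_def freq_def dm .
  qed
  have half: "r div 2 = (r - 1) div 2" using assms(2) by (elim oddE) simp
  define t where "t g = (\<Sum>i\<le>k. y (g, i))" for g
  have t_const: "t g = t 0" if "g < r" for g
  proof (rule dft_eq_0_imp_const[OF _ _ that])
    fix h assume h: "1 \<le> h" "h \<le> r div 2"
    show "dft r (\<lambda>g. of_real (t g)) (int h) = 0"
      using zero'[of "h - 1" 0] h r by (simp add: half V_def s_def t_def)
  qed (use r in simp)
  have "(\<Sum>g<r. t g) = (\<Sum>g<r. t 0)"
    by (rule sum.cong[OF refl], rule t_const) simp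
  moreover have "(\<Sum>g<r. t g) = 1" unfolding t_def by (rule y_sum)
  \<comment> \<open>The common join parameter is nonzero, so every factor can be normalized to a
    point of the simplex.\<close>
  ultimately have "t 0 = 1 / real r" using r by (simp add: field_simps)
  then have t: "t g = 1 / real r" if "g < r" for g
    by (rule trans[OF t_const[OF that]])
  have e: "elem_sym k r (\<lambda>i. y (g, i)) = elem_sym k r (\<lambda>i. y (0, i))" if "g < r" for g
  proof (rule dft_eq_0_imp_const[OF _ _ that])
    fix h assume h: "1 \<le> h" "h \<le> r div 2"
    show "dft r (\<lambda>g. of_real (elem_sym k r (\<lambda>i. y (g, i)))) (int h) = 0"
      using zero'[of "h - 1" 1] h r by (simp add: half V_def)
  qed (use r in simp)
  \<comment> \<open>If one value of \<open>elem_sym\<close> is nonzero, all are, and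
    \<open>r\<close> disjoint supports with at least \<open>r\<close> vertices each need
    \<open>r * r\<close> vertices, more than the available \<open>r * (r - 1) + 1\<close>.\<close>
  have small: "card {i. i \<le> k \<and> y (g, i) \<noteq> 0} < r" if "g < r" for g
  proof (rule ccontr)
    assume "\<not> ?thesis"
    then have "elem_sym k r (\<lambda>i. y (g, i)) \<noteq> 0"
      using elem_sym_eq_0_iff[of "\<lambda>i. y (g, i)"] y_nonneg by simp
    then have "elem_sym k r (\<lambda>i. y (h, i)) \<noteq> 0" if "h < r" for h
      using e[OF that] e[OF \<open>g < r\<close>] by simp
    then have "r \<le> card {i. i \<le> k \<and> y (h, i) \<noteq> 0}" if "h < r" for h
      using elem_sym_eq_0_iff[of "\<lambda>i. y (h, i)"] y_nonneg that by (meson not_le)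
    then have "(\<Sum>h<r. r) \<le> (\<Sum>h<r. card {i. i \<le> k \<and> y (h, i) \<noteq> 0})"
      by (intro sum_mono) auto
    also have "\<dots> \<le> k + 1"
      by (rule sum_card_disjoint_le) (use y_disj in auto)
    finally have "r * r \<le> r * (r - 1) + 1" by (simp add: k_def)
    moreover have "r * r = r * (r - 1) + r" by (cases r) auto
    ultimately show False using r by simp
  qed
  define x where "x g = (\<lambda>i. y (g, i) / t g)" for g
  define w where "w i g = Complex (F (\<lambda>j. y (g, j)) $ c (2 * i)) (F (\<lambda>j. y (g, j)) $ c (2 * i + 1))"
    for i g
  show ?thesis
  proof (rule exI[of _ x], rule exI[of _ "\<lambda>i. dft r (w i) 0"],
      rule exI[of _ "\<lambda>i. dft r (w i) 1"], intro conjI allI impI)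
    show "x g \<in> standard_simplex (r * (r - 1))" if "g < r" for g
      using normalize_in_standard_simplex[OF deleted_join_slice[OF y, of g]] t[OF that] r
      by (simp add: x_def t_def k_def)
    show "card {i. x g i \<noteq> 0} < r" if "g < r" for g
    proof -
      have "{i. x g i \<noteq> 0} = {i. i \<le> k \<and> y (g, i) \<noteq> 0}"
        using t[OF that] r y_out by (auto simp: x_def)
      then show ?thesis using small[OF that] by simp
    qed
    show "x g i = 0 \<or> x h i = 0" if "g < r" "h < r" "g \<noteq> h" for g h i
      using y_disj[OF that(3), of i] by (auto simp: x_def)
    fix g i assume g: "g < r" and i: "i < (r - 1) div 2"
    have "dft r (w i) (int h) = 0" if "h \<in> {2..<r}" for h
      using zero'[OF i, of h] that by (simp add: V_def w_def[abs_def])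
    then have "(\<Sum>h<r. dft r (w i) (int h) * unit_root r (int h * int g)) =
        (\<Sum>h\<in>{0, 1}. dft r (w i) (int h) * unit_root r (int h * int g))"
      using r by (intro sum.mono_neutral_right) auto
    \<comment> \<open>The factor \<open>r\<close> of the inversion formula will cancel the join
      parameter \<open>1 / r\<close>, so both constants are plain \<open>dft\<close> values.\<close>
    then have "of_nat r * w i g = dft r (w i) 0 + dft r (w i) 1 * unit_root r (int g)"
      using dft_inversion[OF g, of "w i"] by simp
    moreover have "F (\<lambda>i. y (g, i)) = (1 / real r) *\<^sub>R f (x g)"
      using t[OF g] by (simp add: F_def s_def t_def x_def)
    then have "of_nat r * w i g = Complex (f (x g) $ c (2 * i)) (f (x g) $ c (2 * i + 1))"
      using r by (simp add: w_def complex_eq_iff)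
    ultimately show "Complex (f (x g) $ c (2 * i)) (f (x g) $ c (2 * i + 1)) =
        dft r (w i) 0 + dft r (w i) 1 * unit_root r (int g)"
      by simp
  qed
qed

section \<open>Faces with prescribed vertices\<close>

definition face :: "nat \<Rightarrow> nat set \<Rightarrow> (nat \<Rightarrow> real) set" where
  "face M A = {x \<in> standard_simplex M. \<forall>i. i \<notin> A \<longrightarrow> x i = 0}"

lemma simplex_face_face:
  assumes "A \<subseteq> {..M}" "A \<noteq> {}"
  shows "simplex_face M (card A - 1) (face M A)"
proof -
  have "card A > 0" using assms finite_subset[OF assms(1)] by (simp add: card_gt_0_iff)
  then show ?thesis
    using assms unfolding simplex_face_def face_def by (intro exI[of _ A]) auto
qed

lemma support_standard_simplex:
  assumes "x \<in> standard_simplex M"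
  shows "{i. x i \<noteq> 0} \<subseteq> {..M}" "{i. x i \<noteq> 0} \<noteq> {}"
proof -
  have "x i = 0" if "i > M" for i
    using assms that unfolding standard_simplex_def by blast
  then show "{i. x i \<noteq> 0} \<subseteq> {..M}"
    by (auto simp: not_less[symmetric])
  have "(\<Sum>i\<le>M. x i) \<noteq> 0" using assms by (simp add: standard_simplex_def)
  then show "{i. x i \<noteq> 0} \<noteq> {}" by (auto intro: ccontr)
qed

text \<open>A common point would have empty support, whereas its coordinates sum to 1.\<close>

lemma face_disjoint:
  assumes "A \<inter> B = {}"
  shows "face M A \<inter> face M B = {}"
proof (rule ccontr)
  assume "\<not> ?thesis"
  then obtain x where x: "x \<in> face M A" "x \<in> face M B" by blast
  then have "{i. x i \<noteq> 0} \<subseteq> A \<inter> B" by (auto simp: face_def)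
  then show False
    using support_standard_simplex(2)[of x M] x assms by (auto simp: face_def)
qed

section \<open>Z/r as a \<open>cyclic_sum\<close> with one summand\<close>

lemma cyclic_sum_apply_0:
  assumes "r > 0" "g \<in> carrier (cyclic_sum 1 (\<lambda>_. r))"
  shows "0 \<le> g 0" "g 0 < int r"
proof -
  have "g 0 \<in> {0..<int r}"
    using assms by (auto simp: carrier_integer_mod_group PiE_def)
  then show "0 \<le> g 0" "g 0 < int r" by auto
qed

lemma bij_betw_carrier_cyclic_sum:
  assumes "r > 0"
  shows "bij_betw (\<lambda>k. \<lambda>j\<in>{..<1}. int k) {..<r} (carrier (cyclic_sum 1 (\<lambda>_. r)))"
proof (rule bij_betw_byWitness[where f' = "\<lambda>g. nat (g 0)"])
  show "\<forall>g\<in>carrier (cyclic_sum 1 (\<lambda>_. r)). (\<lambda>j\<in>{..<1}. int (nat (g 0))) = g"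
    using assms by (auto simp: carrier_integer_mod_group PiE_def extensional_def fun_eq_iff)
  show "\<forall>k\<in>{..<r}. nat ((\<lambda>j\<in>{..<1::nat}. int k) 0) = k" by simp
  show "(\<lambda>k. \<lambda>j\<in>{..<1::nat}. int k) ` {..<r} \<subseteq> carrier (cyclic_sum 1 (\<lambda>_. r))"
    by (rule image_subsetI) (simp add: carrier_integer_mod_group restrict_PiE_iff)
  show "(\<lambda>g. nat (g 0)) ` carrier (cyclic_sum 1 (\<lambda>_. r)) \<subseteq> {..<r}"
  proof (intro image_subsetI)
    fix g assume "g \<in> carrier (cyclic_sum 1 (\<lambda>_. r))"
    from cyclic_sum_apply_0[OF assms this] show "nat (g 0) \<in> {..<r}" by auto
  qed
qed

lemma order_cyclic_sum:
  assumes "r > 0"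
  shows "order (cyclic_sum 1 (\<lambda>_. r)) = r"
  using bij_betw_same_card[OF bij_betw_carrier_cyclic_sum[OF assms]] by (simp add: order_def)

lemma chi_eq_unit_root: "chi 1 (\<lambda>_. r) h g = unit_root r (h 0 * g 0)"
proof -
  have "exp (2 * of_real pi * \<i> / of_nat r) = cis (2 * pi / real r)"
    by (simp add: cis_conv_exp mult.commute)
  moreover have "cis (2 * pi / real r) powi m = unit_root r m" for m
    by (simp add: cis_power_int unit_root_def mult.commute)
  ultimately show ?thesis by (simp add: chi_def)
qed

text \<open>The values of a nontrivial character sum to 0.\<close>

lemma fourier_coeff_const:
  assumes "r > 0" "h \<in> carrier (cyclic_sum 1 (\<lambda>_. r))" "h \<noteq> \<one>\<^bsub>cyclic_sum 1 (\<lambda>_. r)\<^esub>"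
  shows "fourier_coeff 1 (\<lambda>_. r) (\<lambda>_. \<kappa>) h = 0"
proof -
  note h0 = cyclic_sum_apply_0[OF assms(1,2)]
  have "h 0 \<noteq> 0"
  proof
    assume "h 0 = 0"
    then have "h j = (\<lambda>j\<in>{..<1}. 0) j" for j
      using assms(2) by (cases "j = 0") (auto simp: PiE_def extensional_def)
    then have "h = (\<lambda>j\<in>{..<1}. 0)" by (rule ext)
    then show False using assms(3) by simp
  qed
  then have "\<not> int r dvd - h 0"
    using h0 zdvd_imp_le[of "int r" "h 0"] by auto
  then have "(\<Sum>k<r. unit_root r (- h 0 * int k)) = 0"
    using sum_unit_root[OF assms(1), of "- h 0"] by (simp only: if_False)
  moreover have "(\<Sum>g\<in>carrier (cyclic_sum 1 (\<lambda>_. r)). \<kappa> * inverse (chi 1 (\<lambda>_. r) h g)) =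
      (\<Sum>k<r. \<kappa> * unit_root r (- h 0 * int k))"
  proof (subst sum.reindex_bij_betw[OF bij_betw_carrier_cyclic_sum[OF assms(1)], symmetric],
      rule sum.cong[OF refl])
    fix k
    have "inverse (unit_root r (h 0 * int k)) = unit_root r (- h 0 * int k)"
      by (simp add: unit_root_def)
    then show "\<kappa> * inverse (chi 1 (\<lambda>_. r) h (\<lambda>j\<in>{..<1}. int k)) = \<kappa> * unit_root r (- h 0 * int k)"
      unfolding chi_eq_unit_root by simp
  qed
  ultimately show ?thesis by (simp add: fourier_coeff_def flip: sum_distrib_left)
qed

section \<open>Pairing coordinates into planes\<close>

lemma sum_pairs:
  fixes F :: "nat \<Rightarrow> 'b::comm_monoid_add"
  shows "(\<Sum>k<2 * a. F k) = (\<Sum>i<a. F (2 * i) + F (2 * i + 1))"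
  by (induction a) (auto simp: add.assoc)

lemma less_double_cases:
  assumes "k < 2 * (a::nat)"
  shows "\<exists>i<a. k = 2 * i \<or> k = 2 * i + 1"
proof (intro exI conjI)
  show "k div 2 < a" using assms by simp
  show "k = 2 * (k div 2) \<or> k = 2 * (k div 2) + 1" by presburger
qed

lemma coordinate_decomposition_planes:
  fixes c :: "nat \<Rightarrow> 'd::finite"
  assumes c: "bij_betw c {..<2 * a} UNIV" and "a \<ge> 1" and card: "CARD('d) = 2 * a"
  defines "V \<equiv> \<lambda>i. span {axis (c (2 * i)) 1, axis (c (2 * i + 1)) (1::real)}"
  shows "coordinate_decomposition a 0 V"
proof -
  have inj: "c j = c k \<longleftrightarrow> j = k" if "j < 2 * a" "k < 2 * a" for j k
    using c that by (auto simp: bij_betw_def inj_on_def)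
  have plane: "coordinate_plane (V i)" if "i < a" for i
    unfolding coordinate_plane_def V_def
  proof (intro exI conjI)
    show "c (2 * i) \<noteq> c (2 * i + 1)" using inj[of "2 * i" "2 * i + 1"] that by simp
  qed (rule refl)
  have orth: "orthogonal u v" if "i < a" "j < a" "i \<noteq> j" "u \<in> V i" "v \<in> V j" for i j u v
  proof -
    have axes: "orthogonal (axis (c k) (1::real)) (axis (c l) 1)"
      if "k \<in> {2 * i, 2 * i + 1}" "l \<in> {2 * j, 2 * j + 1}" for k l
    proof -
      have div2: "k div 2 = i" "l div 2 = j" using that by auto
      have "k < 2 * a" "l < 2 * a" "k \<noteq> l"
        using that \<open>i < a\<close> \<open>j < a\<close> div2 \<open>i \<noteq> j\<close> by auto
      then show ?thesis using inj[of k l] by (simp add: orthogonal_def inner_axis_axis)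
    qed
    have 1: "orthogonal (axis (c k) 1) v" if k: "k \<in> {2 * i, 2 * i + 1}" for k
    proof (rule orthogonal_to_span)
      show "v \<in> span {axis (c (2 * j)) 1, axis (c (2 * j + 1)) 1}"
        using \<open>v \<in> V j\<close> by (simp add: V_def)
      show "orthogonal (axis (c k) 1) w"
        if "w \<in> {axis (c (2 * j)) 1, axis (c (2 * j + 1)) 1}" for w :: "real ^ 'd"
        using that axes[OF k, of "2 * j"] axes[OF k, of "2 * j + 1"] by auto
    qed
    have "orthogonal v u"
    proof (rule orthogonal_to_span)
      show "u \<in> span {axis (c (2 * i)) 1, axis (c (2 * i + 1)) 1}"
        using \<open>u \<in> V i\<close> by (simp add: V_def)
      show "orthogonal v w"
        if "w \<in> {axis (c (2 * i)) 1, axis (c (2 * i + 1)) 1}" for w :: "real ^ 'd"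
        using that 1[of "2 * i"] 1[of "2 * i + 1"] by (auto simp: orthogonal_commute)
    qed
    then show ?thesis by (simp add: orthogonal_commute)
  qed
  have "Basis \<subseteq> (\<Union>i<a + 0. V i)"
  proof
    fix b :: "real ^ 'd" assume "b \<in> Basis"
    then obtain d where d: "b = axis d 1" by (auto simp: Basis_vec_def)
    have "d \<in> c ` {..<2 * a}" using c by (simp add: bij_betw_imp_surj_on)
    then obtain k where k: "d = c k" "k \<in> {..<2 * a}" by (rule imageE)
    then obtain i where "i < a" "k = 2 * i \<or> k = 2 * i + 1"
      using less_double_cases[of k a] by auto
    then show "b \<in> (\<Union>i<a + 0. V i)"
      using d k(1) by (auto simp: V_def intro!: bexI[of _ i] span_base)
  qed
  then have "span (\<Union>i<a + 0. V i) = UNIV"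
    using span_mono span_Basis by blast
  then show ?thesis
    using plane orth assms(2) card unfolding coordinate_decomposition_def by auto
qed

section \<open>Extracting the regular polygon\<close>

theorem corollary6p3:
  fixes r :: nat and f :: "(nat \<Rightarrow> real) \<Rightarrow> real ^ 'd"
  assumes "Factorial_Ring.prime r" and "odd r"
    and "CARD('d) = r - 1"
    and "continuous_on (standard_simplex (r * (r - 1))) f"
    and "Fourier_generic (r * (r - 1)) f"
  shows "\<exists>\<sigma> x.
    (\<forall>i\<in>{1..r}. (\<exists>k\<le>r - 2. simplex_face (r * (r - 1)) k (\<sigma> i)) \<and> x i \<in> \<sigma> i) \<and>
    disjoint_family_on \<sigma> {1..r} \<and>
    regular_polygon r ((\<lambda>i. f (x i)) ` {1..r})"
proof -
  define M where "M = r * (r - 1)"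
  define a where "a = (r - 1) div 2"
  have a: "r - 1 = 2 * a" using assms(2) by (simp add: a_def)
  have "r \<ge> 2" using assms(1) by (rule prime_ge_2_nat)
  then have r: "r \<ge> 3" using assms(2) by (cases "r = 2") auto
  then have a1: "a \<ge> 1" using a by simp
  have card: "CARD('d) = 2 * a" using assms(3) a by simp
  \<comment> \<open>Any enumeration of the coordinates will do; its consecutive pairs turn the
    target into \<open>a\<close> complex coordinates.\<close>
  obtain c :: "nat \<Rightarrow> 'd" where c: "bij_betw c {..<2 * a} UNIV"
    using ex_bij_betw_nat_finite[of "UNIV :: 'd set"] unfolding card by (auto simp: atLeast0LessThan)
  obtain x C0 C1 where x_simplex: "\<forall>g<r. x g \<in> standard_simplex M"
    and x_card: "\<forall>g<r. card {i. x g i \<noteq> 0} < r"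
    and x_disj: "\<forall>g<r. \<forall>h<r. \<forall>i. g \<noteq> h \<longrightarrow> x g i = 0 \<or> x h i = 0"
    and x_f: "\<forall>g<r. \<forall>i<a.
       Complex (f (x g) $ c (2 * i)) (f (x g) $ c (2 * i + 1)) = C0 i + C1 i * unit_root r (int g)"
    using disjoint_points_two_frequencies[OF assms(1,2,4), of c, folded M_def a_def]
    by (elim exE conjE) (rule that)
  note x_simplex = x_simplex[rule_format] and x_card = x_card[rule_format]
    and x_disj = x_disj[rule_format] and x_f = x_f[rule_format]
  define supp where "supp g = {i. x g i \<noteq> 0}" for g
  have supp: "supp g \<subseteq> {..M}" "supp g \<noteq> {}" "card (supp g) \<le> r - 1" if "g < r" for g
    using support_standard_simplex[OF x_simplex[OF that]] x_card[OF that] by (auto simp: supp_def)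
  have supp_disj: "supp g \<inter> supp h = {}" if "g < r" "h < r" "g \<noteq> h" for g h
    using x_disj[OF that] by (auto simp: supp_def)
  have x_face: "x g \<in> face M (supp g)" if "g < r" for g
    using x_simplex[OF that] by (simp add: face_def supp_def)
  have c_cases: "\<exists>i<a. d = c (2 * i) \<or> d = c (2 * i + 1)" for d
  proof -
    have "d \<in> c ` {..<2 * a}" using c by (simp add: bij_betw_imp_surj_on)
    then obtain k where "d = c k" "k \<in> {..<2 * a}" by (rule imageE)
    then show ?thesis using less_double_cases[of k a] by auto
  qed
  have vec: "\<exists>u :: real ^ 'd. \<forall>i<a. u $ c (2 * i) = Re (w i) \<and> u $ c (2 * i + 1) = Im (w i)"
    for w :: "nat \<Rightarrow> complex"
  proof -
    define idx where "idx = the_inv_into {..<2 * a} c"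
    have idx: "idx (c k) = k" if "k < 2 * a" for k
      using c that by (simp add: idx_def the_inv_into_f_f bij_betw_def)
    show ?thesis
      by (rule exI[of _ "\<chi> d. if even (idx d) then Re (w (idx d div 2)) else Im (w (idx d div 2))"])
        (simp add: idx)
  qed
  have inner: "u \<bullet> v = (\<Sum>i<a. u $ c (2 * i) * v $ c (2 * i) + u $ c (2 * i + 1) * v $ c (2 * i + 1))"
    for u v :: "real ^ 'd"
    using sum.reindex_bij_betw[OF c, of "\<lambda>d. u $ d * v $ d"] by (simp add: inner_vec_def sum_pairs)
  obtain ctr :: "real ^ 'd" where ctr: "\<forall>i<a. ctr $ c (2 * i) = Re (C0 i) \<and> ctr $ c (2 * i + 1) = Im (C0 i)"
    using vec[of C0] by blast
  obtain u :: "real ^ 'd" where u: "\<forall>i<a. u $ c (2 * i) = Re (C1 i) \<and> u $ c (2 * i + 1) = Im (C1 i)"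
    using vec[of C1] by blast
  \<comment> \<open>In complex coordinates \<open>v\<close> is \<open>u\<close> multiplied by the
    imaginary unit, hence orthogonal to \<open>u\<close> and of the same norm.\<close>
  obtain v :: "real ^ 'd" where v: "\<forall>i<a. v $ c (2 * i) = - Im (C1 i) \<and> v $ c (2 * i + 1) = Re (C1 i)"
    using vec[of "\<lambda>i. \<i> * C1 i"] by auto
  have f_x: "f (x g) = ctr + cos (2 * pi * real g / real r) *\<^sub>R u + sin (2 * pi * real g / real r) *\<^sub>R v"
    if "g < r" for g
  proof -
    have "f (x g) $ d = (ctr + cos (2 * pi * real g / real r) *\<^sub>R u
        + sin (2 * pi * real g / real r) *\<^sub>R v) $ d" for d
    proof -
      obtain i where i: "i < a" "d = c (2 * i) \<or> d = c (2 * i + 1)" using c_cases by blast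
      have "f (x g) $ c (2 * i) = Re (C0 i + C1 i * unit_root r (int g))"
        "f (x g) $ c (2 * i + 1) = Im (C0 i + C1 i * unit_root r (int g))"
        using x_f[OF that i(1)] by (metis complex.sel)+
      then show ?thesis
        using i ctr u v by (auto simp: unit_root_def algebra_simps)
    qed
    then show ?thesis by (simp add: vec_eq_iff)
  qed
  \<comment> \<open>If \<open>u\<close> were 0, all \<open>f (x g)\<close> would coincide and every
    nontrivial Fourier coefficient would vanish, against genericity.\<close>
  have "u \<noteq> 0"
  proof
    assume "u = 0"
    then have C1: "C1 i = 0" if "i < a" for i
      using u that by (simp add: complex_eq_iff)
    let ?G = "cyclic_sum 1 (\<lambda>_. r)"
    define V where "V i = span {axis (c (2 * i)) 1, axis (c (2 * i + 1)) (1::real)}" for i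
    \<comment> \<open>All nonzero frequencies in each of the \<open>a\<close> planes, and no lines,
      so \<open>m = a * (r - 1)\<close> and \<open>m' = 0\<close>.\<close>
    define S where "S = (\<lambda>_::nat. carrier ?G - {\<one>\<^bsub>?G\<^esub>})"
    define A where "A = (\<Union>g<r. supp g)"
    define x' where "x' g = x (nat (g 0))" for g :: "nat \<Rightarrow> int"
    have G0: "nat (g 0) < r" if "g \<in> carrier ?G" for g
      using cyclic_sum_apply_0[OF _ that] r by (simp add: nat_less_iff)
    have G0_inj: "nat (g 0) \<noteq> nat (h 0)" if "g \<in> carrier ?G" "h \<in> carrier ?G" "g \<noteq> h" for g h
    proof -
      have "inj_on (\<lambda>g. nat (g 0)) (carrier ?G)"
        by (rule inj_on_inverseI[where g = "\<lambda>k. \<lambda>j\<in>{..<1}. int k"])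
          (use r in \<open>auto simp: carrier_integer_mod_group PiE_def extensional_def fun_eq_iff\<close>)
      then show ?thesis using that unfolding inj_on_def by blast
    qed
    have order: "order ?G = r" using order_cyclic_sum r by simp
    have "coordinate_decomposition a 0 V"
      unfolding V_def by (rule coordinate_decomposition_planes[OF c a1 card])
    moreover have "coordinate_permutation a 0 V c"
      using c by (simp add: coordinate_permutation_def V_def)
    moreover have "admissible 1 (\<lambda>_. r) a 0 S"
      by (simp add: admissible_def S_def)
    moreover have A: "A \<subseteq> {..M}" "A \<noteq> {}"
    proof -
      show "A \<subseteq> {..M}" unfolding A_def by (rule UN_least) (simp add: supp(1))
      have "supp 0 \<subseteq> A" unfolding A_def using r by (intro UN_upper) simp
      then show "A \<noteq> {}" using supp(2)[of 0] r by auto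
    qed
    then have "simplex_face M (card A - 1) (face M A)"
      by (rule simplex_face_face)
    \<comment> \<open>The right side equals \<open>r * (r - 1)\<close>. The whole simplex has
      exactly this dimension and just fails; \<open>A\<close> has at most \<open>r * (r - 1)\<close>
      vertices, so its face passes by one.\<close>
    moreover have "int (card A - 1) < 2 * int (\<Sum>i<a + 0. card (S i))
        - int (\<Sum>i=a..<a + 0. card (order_two_part 1 (\<lambda>_. r) (S i))) + int (order ?G) - 1"
    proof -
      have "card A \<le> (\<Sum>g<r. card (supp g))" unfolding A_def by (rule card_UN_le) simp
      also have "\<dots> \<le> (\<Sum>g<r. r - 1)" by (intro sum_mono) (use supp in auto)
      finally have "card A \<le> r * (r - 1)" by simp
      moreover have "card A > 0"
        using A finite_subset[OF A(1)] by (simp add: card_gt_0_iff)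
      ultimately have "card A - 1 < r * (r - 1)" by linarith
      moreover have "card (S i) = r - 1" for i
      proof -
        interpret G: group ?G by (rule product_group) simp
        show ?thesis
          using order unfolding S_def order_def by (simp only: card_Diff_singleton[OF G.one_closed])
      qed
      moreover have "2 * (a * (r - 1)) + (r - 1) = r * (r - 1)"
        using a r by (cases r) (auto simp: algebra_simps)
      ultimately show ?thesis using order r by (simp add: of_nat_diff flip: of_nat_mult)
    qed
    moreover have "\<forall>g\<in>carrier ?G. x' g \<in> face M A"
    proof
      fix g assume "g \<in> carrier ?G"
      then show "x' g \<in> face M A"
        using x_face[OF G0] G0 by (auto simp: x'_def face_def A_def)
    qed
    moreover have "disjoint_support M (carrier ?G) x'"
      unfolding disjoint_support_def
    proof (intro exI[of _ "\<lambda>g. face M (supp (nat (g 0)))"] conjI ballI)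
      fix g assume g: "g \<in> carrier ?G"
      show "\<exists>k. simplex_face M k (face M (supp (nat (g 0))))"
        using simplex_face_face[OF supp(1,2)[OF G0[OF g] ]] by blast
      show "x' g \<in> face M (supp (nat (g 0)))"
        unfolding x'_def by (rule x_face[OF G0[OF g]])
    next
      show "disjoint_family_on (\<lambda>g. face M (supp (nat (g 0)))) (carrier ?G)"
        unfolding disjoint_family_on_def
      proof (intro ballI impI)
        fix g h assume "g \<in> carrier ?G" "h \<in> carrier ?G" "g \<noteq> h"
        then show "face M (supp (nat (g 0))) \<inter> face M (supp (nat (h 0))) = {}"
          by (intro face_disjoint supp_disj G0 G0_inj)
      qed
    qed
    moreover have "\<forall>i<a + 0. \<forall>h\<in>S i.
        fourier_coeff 1 (\<lambda>_. r) (\<lambda>g. sigma_component a c (f (x' g)) i) h = 0"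
    proof (intro allI impI ballI)
      fix i h assume i: "i < a + 0" and h: "h \<in> S i"
      have "sigma_component a c (f (x' g)) i = C0 i" if "g \<in> carrier ?G" for g
        using x_f[OF G0[OF that], of i] i C1[of i] by (simp add: sigma_component_def x'_def)
      then have "fourier_coeff 1 (\<lambda>_. r) (\<lambda>g. sigma_component a c (f (x' g)) i) h =
          fourier_coeff 1 (\<lambda>_. r) (\<lambda>_. C0 i) h"
        unfolding fourier_coeff_def by (intro arg_cong2[where f = "(*)"] refl sum.cong) simp
      also have "\<dots> = 0"
        using h r by (intro fourier_coeff_const) (simp_all add: S_def)
      finally show "fourier_coeff 1 (\<lambda>_. r) (\<lambda>g. sigma_component a c (f (x' g)) i) h = 0" .
    qed
    ultimately show False
      using assms(5)[folded M_def, unfolded Fourier_generic_def, rule_format,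
          of 1 "\<lambda>_. r" a 0 V c S "card A - 1" "face M A"] r by auto
  qed
  moreover have "norm u = norm v"
    using u v by (simp add: norm_eq inner add.commute)
  moreover have "orthogonal u v"
    using u v by (simp add: orthogonal_def inner)
  \<comment> \<open>The conclusion numbers the points from 1, the construction from 0.\<close>
  moreover have "(\<lambda>i. f (x (i - 1))) ` {1..r} = (\<lambda>k. ctr + cos (2 * pi * real k / real r) *\<^sub>R u
      + sin (2 * pi * real k / real r) *\<^sub>R v) ` {..<r}"
  proof -
    have "{..<r} = (\<lambda>i. i - 1) ` {1..r}"
      using image_Suc_lessThan[of r] by (force simp: image_image simp flip: image_Suc_lessThan)
    then have "(\<lambda>i. f (x (i - 1))) ` {1..r} = (\<lambda>k. f (x k)) ` {..<r}"
      by (simp add: image_image)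
    also have "\<dots> = (\<lambda>k. ctr + cos (2 * pi * real k / real r) *\<^sub>R u
      + sin (2 * pi * real k / real r) *\<^sub>R v) ` {..<r}"
      by (rule image_cong[OF refl]) (simp add: f_x)
    finally show ?thesis .
  qed
  ultimately have "regular_polygon r ((\<lambda>i. f (x (i - 1))) ` {1..r})"
    using r unfolding regular_polygon_def by blast
  moreover have "\<exists>k\<le>r - 2. simplex_face M k (face M (supp (i - 1)))"
    "x (i - 1) \<in> face M (supp (i - 1))" if "i \<in> {1..r}" for i
  proof -
    have i: "i - 1 < r" using that by auto
    show "x (i - 1) \<in> face M (supp (i - 1))" by (rule x_face[OF i])
    show "\<exists>k\<le>r - 2. simplex_face M k (face M (supp (i - 1)))"
      using simplex_face_face[OF supp(1,2)[OF i]] supp(3)[OF i]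
      by (intro exI[of _ "card (supp (i - 1)) - 1"]) auto
  qed
  moreover have "disjoint_family_on (\<lambda>i. face M (supp (i - 1))) {1..r}"
    unfolding disjoint_family_on_def
  proof (intro ballI impI)
    fix i j assume "i \<in> {1..r}" "j \<in> {1..r}" "i \<noteq> j"
    then show "face M (supp (i - 1)) \<inter> face M (supp (j - 1)) = {}"
      by (intro face_disjoint supp_disj) auto
  qed
  ultimately show ?thesis
    unfolding M_def[symmetric]
    by (intro exI[of _ "\<lambda>i. face M (supp (i - 1))"] exI[of _ "\<lambda>i. x (i - 1)"]) blast
qed

end
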